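(* Let $M>0$ and let $m,n,k$ be positive integers. Let $g_1,\ldots,g_w\in\mathbb{F}_n\setminus\{e\}$ be reduced words with $\sum_{i=1}^{w}\mathrm{length}(g_i)=m$, and let $x_1,\ldots,x_w$ be commuting normal $k\times k$ complex matrices with $\mathrm{Tr}(x_i)=0$ and $\|x_i\|\le M$ for $1\le i\le w$. Then: (1) $$\left|\int_{\mathcal{U}_k^n}\tau_k\big(g_1(\vec u)x_1g_2(\vec u)x_2\cdots g_w(\vec u)x_w\big)\,d\mu_k^n(\vec u)\right| \le \frac{B(m)\,2^{m^2}(Mw)^w}{k};$$ (2) $$\int_{\mathcal{U}_k^n}\left|\tau_k\big(g_1(\vec u)x_1g_2(\vec u)x_2\cdots g_w(\vec u)x_w\big)\right|^2 d\mu_k^n(\vec u) \le \frac{B(2m)\,4^{m^2}(2Mw)^{2w}}{k^2};$$ (3) if $\varepsilon>0$ and $k>\frac{2B(m)2^{m^2}(Mw)^w}{\varepsilon}$, then $$\mu_k^n\Big(\big\{\vec v\in\mathcal{U}_k^n : \big|\tau_k\big(g_1(\vec v)x_1g_2(\vec v)x_2\cdots g_w(\vec v)x_w\big)\big|\ge\varepsilon\big\}\Big) \le \frac{4B(2m)\,4^{m^2}(2Mw)^{2w}}{k^2\varepsilon^2}.$$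
   Context: $\tau_k=\frac1k\mathrm{Tr}$ is the normalized trace on $k\times k$ complex matrices; $\|\cdot\|$ is the operator norm. $\mathcal{U}_k$ is the unitary group of $k\times k$ matrices with normalized Haar measure $\mu_k$; $\mathcal{U}_k^n$ is the product of $n$ copies with product measure $\mu_k^n$. $\mathbb{F}_n$ is the free group on standard generators $h_1,\ldots,h_n$ with identity $e$; for $g\in\mathbb{F}_n$ and $\vec u=(u_1,\ldots,u_n)\in\mathcal{U}_k^n$, $g(\vec u)$ is the image of $g$ under the homomorphism $\mathbb{F}_n\to\mathcal{U}_k$ sending $h_j\mapsto u_j$. $B(m)$ denotes the Bell number of $m$, i.e. the number of equivalence relations on a set of cardinality $m$. *)

theory Defs
  imports "HOL-Analysis.Analysis" "HOL-Probability.Probability"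
begin

type_synonym 'k cmat = "complex^'k^'k"

definition ctrans :: "'k::finite cmat \<Rightarrow> 'k cmat" where
  "ctrans A = map_matrix cnj (transpose A)"

definition unitary_mats :: "'k::finite cmat set" where
  "unitary_mats = {U. U ** ctrans U = mat 1 \<and> ctrans U ** U = mat 1}"

definition ntrace :: "'k::finite cmat \<Rightarrow> complex" where
  "ntrace A = trace A / of_nat CARD('k)"

definition opnorm :: "'k::finite cmat \<Rightarrow> real" where
  "opnorm A = onorm (\<lambda>v. A *v v)"

definition normal_mat :: "'k::finite cmat \<Rightarrow> bool" where
  "normal_mat A \<longleftrightarrow> A ** ctrans A = ctrans A ** A"

definition is_haar_unitary :: "'k::finite cmat measure \<Rightarrow> bool" where
  "is_haar_unitary \<mu> \<longleftrightarrow>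
     prob_space \<mu> \<and>
     space \<mu> = unitary_mats \<and> sets \<mu> = sets (restrict_space borel unitary_mats) \<and>
     (\<forall>g\<in>unitary_mats. \<forall>A\<in>sets \<mu>. emeasure \<mu> ((\<lambda>u. g ** u) ` A) = emeasure \<mu> A)"

text \<open>Elements of the free group \<open>F_n\<close> as words: a letter \<open>(j, False)\<close> stands for
  the generator \<open>h_{j+1}\<close>, \<open>(j, True)\<close> for its inverse (generators indexed \<open>0..n-1\<close>).\<close>
type_synonym fword = "(nat \<times> bool) list"

definition word_over :: "nat \<Rightarrow> fword \<Rightarrow> bool" where
  "word_over n g \<longleftrightarrow> (\<forall>l\<in>set g. fst l < n)"

fun reduced_word :: "fword \<Rightarrow> bool" where
  "reduced_word (a # b # rest) \<longleftrightarrow> \<not> (fst a = fst b \<and> snd a \<noteq> snd b) \<and> reduced_word (b # rest)"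
| "reduced_word _ \<longleftrightarrow> True"

definition eval_word :: "fword \<Rightarrow> (nat \<Rightarrow> 'k::finite cmat) \<Rightarrow> 'k cmat" where
  "eval_word g u = foldr (\<lambda>(j, inv) acc. (if inv then matrix_inv (u j) else u j) ** acc) g (mat 1)"

definition word_product :: "fword list \<Rightarrow> 'k::finite cmat list \<Rightarrow> (nat \<Rightarrow> 'k cmat) \<Rightarrow> 'k cmat" where
  "word_product gs xs u = foldr (\<lambda>(g, x) acc. eval_word g u ** x ** acc) (zip gs xs) (mat 1)"

definition bell :: "nat \<Rightarrow> nat" where
  "bell m = card {R. equiv {..<m} R}"

end

theory Submission
  imports Defs
begin

text \<open>
  The measure is invariant under \<open>u\<^sub>j \<mapsto> g u\<^sub>j\<close> with \<open>g = 1 + (e\<^sup>i\<^sup>t - 1) v v\<^sup>*\<close>, \<open>v\<close> a unit vector.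
  Differentiating at \<open>t = 0\<close>, polarising in \<open>v\<close> and summing over matrix units yields the loop
  (Schwinger-Dyson) equation: for a word \<open>l\<^sub>1 a\<^sub>1 \<dots> l\<^sub>r a\<^sub>r\<close> in Haar unitaries and constant contractions
  and a function \<open>H\<close>, the mean of \<open>\<tau>(l\<^sub>1 a\<^sub>1 \<dots> l\<^sub>r a\<^sub>r) H\<close> is a signed sum, over the later occurrences of
  \<open>l\<^sub>1\<close> or its inverse, of means of \<open>\<tau>(\<dots>) \<tau>(\<dots>) H\<close> in which the word is cut at this occurrence, plus
  an error \<open>N/k\<^sup>2\<close> coming from the gradient of \<open>H\<close>, which has norm at most \<open>N/k\<close>.

  If \<open>\<tau>(a\<^sub>i) = 0\<close> whenever \<open>l\<^sub>i\<close> and \<open>l\<^sub>i\<^sub>+\<^sub>1\<close> are inverse to each other, then the first of the two pieces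
  is again such a word and shorter, or it is a single \<open>a\<^sub>i\<close> of trace zero; the second is absorbed into
  \<open>H\<close>. By induction the mean is at most \<open>2\<^sup>r\<^sup>-\<^sup>1 (N + r)/k\<^sup>2\<close>. Part (1) is \<open>H = 1\<close>, part (2) is
  \<open>H = cnj \<tau>(\<dots>)\<close>, and part (3) follows from (2) by Markov's inequality.
\<close>

section \<open>Norm bounds for complex matrices\<close>

text \<open>An upper bound on the operator norm in pointwise form, so that products, sums and
  adjoints can be estimated without handling a supremum.\<close>

definition mbound :: "real \<Rightarrow> 'k::finite cmat \<Rightarrow> bool" where
  "mbound K A \<longleftrightarrow> (\<forall>v. norm (A *v v) \<le> K * norm v)"

lemma mbound_mult:
  assumes "mbound K A" "mbound L B" "0 \<le> K"
  shows "mbound (K * L) (A ** B)"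
  unfolding mbound_def
proof
  fix v
  have "norm ((A ** B) *v v) \<le> K * norm (B *v v)"
    using assms(1) by (simp add: mbound_def flip: matrix_vector_mul_assoc)
  also have "\<dots> \<le> K * (L * norm v)"
    using assms(2,3) by (intro mult_left_mono) (auto simp: mbound_def)
  finally show "norm ((A ** B) *v v) \<le> K * L * norm v"
    by (simp add: mult.assoc)
qed

lemma mbound_mono:
  assumes "mbound K A" "K \<le> L"
  shows "mbound L A"
  using assms unfolding mbound_def by (meson mult_right_mono norm_ge_zero order_trans)

lemma mbound_mult1: "mbound 1 A \<Longrightarrow> mbound 1 B \<Longrightarrow> mbound 1 (A ** B)"
  using mbound_mult[of 1 A 1 B] by simp

lemma mbound_one [simp]: "mbound 1 (mat 1)"
  by (simp add: mbound_def)

lemma mbound_zero [simp]: "mbound 0 0"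
  by (simp add: mbound_def)

lemma mbound_add:
  assumes "mbound K A" "mbound L B"
  shows "mbound (K + L) (A + B)"
  unfolding mbound_def
proof
  fix v
  have "norm ((A + B) *v v) \<le> norm (A *v v) + norm (B *v v)"
    by (simp add: matrix_vector_mult_add_rdistrib norm_triangle_ineq)
  also have "\<dots> \<le> K * norm v + L * norm v"
    using assms by (intro add_mono) (auto simp: mbound_def)
  finally show "norm ((A + B) *v v) \<le> (K + L) * norm v"
    by (simp add: algebra_simps)
qed

definition smat :: "complex \<Rightarrow> 'k::finite cmat \<Rightarrow> 'k cmat" where
  "smat c A = (\<chi> i j. c * A $ i $ j)"

lemma smat_nth [simp]: "smat c A $ i $ j = c * A $ i $ j"
  by (simp add: smat_def)

lemma smat_mult_left: "smat c A ** B = smat c (A ** B)"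
  by (simp add: vec_eq_iff matrix_matrix_mult_def sum_distrib_left mult.assoc)

lemma smat_mult_right: "A ** smat c B = smat c (A ** B)"
  by (simp add: vec_eq_iff matrix_matrix_mult_def sum_distrib_left algebra_simps)

lemma trace_smat: "trace (smat c A) = c * trace A"
  by (simp add: trace_def sum_distrib_left)

lemma norm_vector_smult: "norm (c *s (v :: complex ^ 'n)) = cmod c * norm v"
  by (simp add: norm_vec_def norm_mult L2_set_right_distrib)

lemma mbound_smat:
  assumes "mbound K A"
  shows "mbound (cmod c * K) (smat c A)"
  unfolding mbound_def
proof
  fix v
  have "smat c A *v v = c *s (A *v v)"
    by (simp add: vec_eq_iff matrix_vector_mult_def sum_distrib_left mult.assoc)
  then have "norm (smat c A *v v) = cmod c * norm (A *v v)"
    by (simp add: norm_vector_smult)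
  also have "\<dots> \<le> cmod c * (K * norm v)"
    using assms by (intro mult_left_mono) (auto simp: mbound_def)
  finally show "norm (smat c A *v v) \<le> cmod c * K * norm v"
    by (simp add: mult.assoc)
qed

lemma mbound_sum_list:
  assumes "\<And>x. x \<in> set xs \<Longrightarrow> mbound 1 (f x)"
  shows "mbound (real (length xs)) (\<Sum>x\<leftarrow>xs. f x)"
  using assms by (induction xs) (auto intro!: mbound_add)

text \<open>An entry is a coordinate of the image of a standard unit vector.\<close>

lemma cmod_entry_le:
  assumes "mbound K A"
  shows "cmod (A $ i $ j) \<le> K"
proof -
  have "A $ i $ j = (A *v axis j 1) $ i"
    by (simp add: matrix_vector_mult_def axis_def if_distrib cong: if_cong)
  also have "cmod \<dots> \<le> norm (A *v axis j 1)"
    by (rule Finite_Cartesian_Product.norm_nth_le)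
  also have "\<dots> \<le> K * norm (axis j (1::complex))"
    using assms unfolding mbound_def by blast
  also have "norm (axis j (1::complex)) = 1"
    by (simp add: norm_vec_def L2_set_def axis_def if_distrib[of cmod] if_distrib[of "\<lambda>x. x\<^sup>2"] cong: if_cong)
  finally show ?thesis by simp
qed

lemma cmod_ntrace_le:
  fixes A :: "'k::finite cmat"
  assumes "mbound K A"
  shows "cmod (ntrace A) \<le> K"
proof -
  have "cmod (trace A) \<le> (\<Sum>i\<in>(UNIV::'k set). K)"
    unfolding trace_def by (rule sum_norm_le) (rule cmod_entry_le[OF assms])
  then have "cmod (trace A) \<le> real CARD('k) * K" by simp
  then show ?thesis
    by (simp add: ntrace_def norm_divide field_simps)
qed

lemma mbound_opnorm: "mbound (opnorm A) A"
  unfolding mbound_def opnorm_def by (intro allI onorm matrix_vector_mul_bounded_linear)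

section \<open>Adjoints and unitary matrices\<close>

lemma ctrans_nth [simp]: "ctrans A $ i $ j = cnj (A $ j $ i)"
  by (simp add: ctrans_def map_matrix_def transpose_def)

lemma ctrans_mult: "ctrans (A ** B) = ctrans B ** ctrans A"
  by (simp add: vec_eq_iff matrix_matrix_mult_def mult.commute)

lemma ctrans_ctrans [simp]: "ctrans (ctrans A) = A"
  by (simp add: vec_eq_iff)

lemma sum_cnj_mult_self: "(\<Sum>i\<in>UNIV. cnj (v $ i) * v $ i) = complex_of_real ((norm (v :: complex ^ 'n))\<^sup>2)"
proof -
  have "cnj z * z = complex_of_real ((cmod z)\<^sup>2)" for z
    by (metis complex_norm_square mult.commute)
  then show ?thesis
    by (simp add: norm_vec_def L2_set_def sum_nonneg)
qed

text \<open>The adjoint relation for the Hermitian inner product, which is written throughout as a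
  sum over coordinates.\<close>

lemma sum_cnj_adjoint:
  "(\<Sum>i\<in>UNIV. cnj (w $ i) * (ctrans A *v v) $ i) = (\<Sum>j\<in>UNIV. cnj ((A *v w) $ j) * v $ j)"
  unfolding matrix_vector_mult_def
  by (simp add: sum_distrib_left sum_distrib_right) (subst sum.swap, simp add: algebra_simps)

lemma cmod_sum_cnj_le: "cmod (\<Sum>i\<in>UNIV. cnj (v $ i) * w $ i) \<le> norm v * norm (w :: complex ^ 'n)"
proof -
  have "cmod (\<Sum>i\<in>UNIV. cnj (v $ i) * w $ i) \<le> (\<Sum>i\<in>UNIV. \<bar>cmod (v $ i)\<bar> * \<bar>cmod (w $ i)\<bar>)"
    by (rule sum_norm_le) (simp add: norm_mult)
  also have "\<dots> \<le> norm v * norm w"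
    unfolding norm_vec_def by (rule L2_set_mult_ineq)
  finally show ?thesis .
qed

text \<open>With \<open>y = ctrans A *v v\<close>, the adjoint relation and Cauchy-Schwarz give
  |y|^2 = <A y, v> \<le> K |y| |v|; divide by |y|.\<close>

lemma mbound_ctrans:
  assumes "mbound K A" "0 \<le> K"
  shows "mbound K (ctrans A)"
  unfolding mbound_def
proof
  fix v
  define y where "y = ctrans A *v v"
  have "complex_of_real ((norm y)\<^sup>2) = (\<Sum>j\<in>UNIV. cnj ((A *v y) $ j) * v $ j)"
    unfolding sum_cnj_mult_self[symmetric] using sum_cnj_adjoint[of y A v] by (simp add: y_def)
  then have "(norm y)\<^sup>2 \<le> norm (A *v y) * norm v"
    using cmod_sum_cnj_le[of "A *v y" v] by (metis abs_of_nonneg norm_of_real zero_le_power2)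
  also have "\<dots> \<le> (K * norm y) * norm v"
    using assms by (intro mult_right_mono) (auto simp: mbound_def)
  finally have "norm y * norm y \<le> norm y * (K * norm v)"
    by (simp add: power2_eq_square algebra_simps)
  then show "norm (ctrans A *v v) \<le> K * norm v"
    using assms(2) by (cases "norm y = 0") (auto simp: y_def mult_le_cancel_left)
qed

lemma unitary_mult: "U \<in> unitary_mats \<Longrightarrow> V \<in> unitary_mats \<Longrightarrow> U ** V \<in> unitary_mats"
  by (simp add: unitary_mats_def ctrans_mult matrix_mul_assoc)
    (metis matrix_mul_assoc matrix_mul_rid)

lemma mbound_unitary:
  assumes "U \<in> unitary_mats"
  shows "mbound 1 U"
  unfolding mbound_def
proof
  fix v
  have "complex_of_real ((norm (U *v v))\<^sup>2) = (\<Sum>i\<in>UNIV. cnj (v $ i) * (ctrans U *v (U *v v)) $ i)"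
    unfolding sum_cnj_mult_self[symmetric] by (rule sum_cnj_adjoint[symmetric])
  also have "ctrans U *v (U *v v) = v"
    using assms by (simp add: matrix_vector_mul_assoc unitary_mats_def)
  also have "(\<Sum>i\<in>UNIV. cnj (v $ i) * v $ i) = complex_of_real ((norm v)\<^sup>2)"
    by (rule sum_cnj_mult_self)
  finally have "(norm (U *v v))\<^sup>2 = (norm v)\<^sup>2"
    using of_real_eq_iff by blast
  then show "norm (U *v v) \<le> 1 * norm v"
    by simp
qed

lemma matrix_inv_unitary:
  assumes "U \<in> unitary_mats"
  shows "matrix_inv U = ctrans U"
proof -
  have *: "U ** ctrans U = mat 1" "ctrans U ** U = mat 1"
    using assms by (auto simp: unitary_mats_def)
  \<comment> \<open>\<open>matrix_inv\<close> chooses some two-sided inverse;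
    \<open>ctrans U\<close> witnesses that one exists.\<close>
  have "U ** matrix_inv U = mat 1"
    unfolding matrix_inv_def by (rule someI2[where a = "ctrans U"]) (use * in auto)
  then show ?thesis
    by (metis * matrix_mul_assoc matrix_mul_lid matrix_mul_rid)
qed

text \<open>\<open>phase_mat v t\<close> multiplies the unit vector \<open>v\<close> by \<open>exp (i t)\<close> and fixes its orthogonal complement.\<close>

definition phase_mat :: "complex ^ 'k::finite \<Rightarrow> real \<Rightarrow> 'k cmat" where
  "phase_mat v t = mat 1 + (\<chi> i p. (iexp t - 1) * (v $ i * cnj (v $ p)))"

text \<open>A rank-one perturbation of the identity: the whole dependence on \<open>t\<close> sits
  in the scalar \<open>iexp t - 1\<close>, which \<open>taylor_entry\<close> expands.\<close>

lemma phase_mat_mult: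
  "(phase_mat v t ** U) $ a $ b =
     U $ a $ b + (iexp t - 1) * (\<Sum>p\<in>UNIV. v $ a * cnj (v $ p) * U $ p $ b)"
proof -
  have "(phase_mat v t ** U) $ a $ b =
      (\<Sum>p\<in>UNIV. (if p = a then U $ p $ b else 0) + (iexp t - 1) * (v $ a * cnj (v $ p) * U $ p $ b))"
    unfolding phase_mat_def matrix_matrix_mult_def
    by (simp, rule sum.cong) (auto simp: mat_def algebra_simps)
  then show ?thesis
    by (simp add: sum.distrib sum_distrib_left)
qed

lemma ctrans_phase_mat: "ctrans (phase_mat v t) = phase_mat v (- t)"
  by (simp add: phase_mat_def vec_eq_iff mat_def exp_cnj)

text \<open>For a unit vector, v v* is a projection, so the phases \<open>s\<close> and
  \<open>- s\<close> cancel in the product; the factor with \<open>- s\<close> is the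
  adjoint.\<close>

lemma phase_mat_unitary:
  assumes "norm v = 1"
  shows "phase_mat v t \<in> unitary_mats"
proof -
  have 1: "(\<Sum>p\<in>UNIV. cnj (v $ p) * v $ p) = 1"
    using sum_cnj_mult_self[of v] assms by simp
  have *: "phase_mat v s ** phase_mat v (- s) = mat 1" for s
  proof -
    have "(phase_mat v s ** phase_mat v (- s)) $ a $ b = mat 1 $ a $ b" for a b
    proof -
      have "(\<Sum>p\<in>UNIV. v $ a * cnj (v $ p) * phase_mat v (- s) $ p $ b)
          = (\<Sum>p\<in>UNIV. if p = b then v $ a * cnj (v $ p) else 0) +
            (\<Sum>p\<in>UNIV. (cnj (v $ p) * v $ p) * ((iexp (-s) - 1) * (v $ a * cnj (v $ b))))"
        unfolding sum.distrib[symmetric]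
        by (rule sum.cong) (auto simp: phase_mat_def mat_def algebra_simps)
      also have "\<dots> = iexp (-s) * (v $ a * cnj (v $ b))"
        unfolding sum_distrib_right[symmetric] 1 by (simp add: algebra_simps)
      finally show ?thesis
        unfolding phase_mat_mult
        by (simp add: phase_mat_def algebra_simps exp_add[symmetric])
    qed
    then show ?thesis by (simp add: vec_eq_iff)
  qed
  show ?thesis
    using *[of t] *[of "-t"] by (simp add: unitary_mats_def ctrans_phase_mat)
qed

section \<open>Invariance of the product Haar measure\<close>

definition rot :: "nat \<Rightarrow> 'k::finite cmat \<Rightarrow> (nat \<Rightarrow> 'k cmat) \<Rightarrow> nat \<Rightarrow> 'k cmat" where
  "rot j g u = u(j := g ** u j)"

locale haar_power =
  fixes \<mu> :: "'k::finite cmat measure" and n :: nat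
  assumes haar: "is_haar_unitary \<mu>"
begin

abbreviation PP :: "(nat \<Rightarrow> 'k cmat) measure" where
  "PP \<equiv> PiM {..<n} (\<lambda>_. \<mu>)"

sublocale mu: prob_space \<mu>
  using haar by (simp add: is_haar_unitary_def)

sublocale prod: product_prob_space "\<lambda>_. \<mu>" "{..<n}"
  by unfold_locales

lemma measure_space_PP: "measure PP (space PP) = 1"
  by (rule prob_space.prob_space, rule prob_space_PiM) unfold_locales

lemma space_mu: "space \<mu> = unitary_mats"
  and sets_mu: "sets \<mu> = sets (restrict_space borel unitary_mats)"
  using haar by (auto simp: is_haar_unitary_def)

lemma space_PP_unitary: "u \<in> space PP \<Longrightarrow> j < n \<Longrightarrow> u j \<in> unitary_mats"
  by (auto simp: space_PiM space_mu)

lemma measurable_entry_mu: "(\<lambda>U. U $ a $ b) \<in> borel_measurable \<mu>"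
proof -
  have "(\<lambda>U::'k cmat. U $ a $ b) \<in> borel_measurable borel"
    by (intro borel_measurable_continuous_onI continuous_intros)
  then have "(\<lambda>U::'k cmat. U $ a $ b) \<in> borel_measurable (restrict_space borel unitary_mats)"
    by (rule measurable_restrict_space1)
  then show ?thesis
    using measurable_cong_sets[OF sets_mu refl, of borel] by blast
qed

lemma measurable_entry:
  assumes "j < n"
  shows "(\<lambda>u. u j $ a $ b) \<in> borel_measurable PP"
  using measurable_compose[OF measurable_component_singleton[of j "{..<n}" "\<lambda>_. \<mu>"] measurable_entry_mu] assms
  by simp

lemma measurable_mult_left:
  assumes "g \<in> unitary_mats"
  shows "(\<lambda>U. g ** U) \<in> measurable \<mu> \<mu>"
proof -
  have "(\<lambda>U::'k cmat. g ** U) \<in> borel_measurable borel"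
    unfolding matrix_matrix_mult_def
    by (intro borel_measurable_continuous_onI continuous_intros)
  then have "(\<lambda>U. g ** U) \<in> measurable (restrict_space borel unitary_mats) (restrict_space borel unitary_mats)"
    by (rule measurable_restrict_space3) (use assms in \<open>auto intro: unitary_mult\<close>)
  then show ?thesis
    using measurable_cong_sets[OF sets_mu sets_mu] by blast
qed

text \<open>Haar invariance is given for images. The preimage under left multiplication by
  \<open>g\<close> is the image under \<open>ctrans g\<close>, to which invariance applies.\<close>

lemma emeasure_vimage_mult_left:
  assumes "g \<in> unitary_mats" "A \<in> sets \<mu>"
  shows "emeasure \<mu> ((\<lambda>U. g ** U) -` A \<inter> space \<mu>) = emeasure \<mu> A"
proof -
  have inv: "ctrans g ** g = mat 1" "g ** ctrans g = mat 1" and g': "ctrans g \<in> unitary_mats"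
    using assms(1) by (auto simp: unitary_mats_def)
  have "(\<lambda>U. g ** U) -` A \<inter> space \<mu> = (\<lambda>U. ctrans g ** U) ` A"
  proof (intro equalityI subsetI)
    fix U assume "U \<in> (\<lambda>U. g ** U) -` A \<inter> space \<mu>"
    moreover have "U = ctrans g ** (g ** U)" by (simp add: matrix_mul_assoc inv)
    ultimately show "U \<in> (\<lambda>U. ctrans g ** U) ` A" by blast
  next
    fix U assume "U \<in> (\<lambda>U. ctrans g ** U) ` A"
    then obtain V where V: "V \<in> A" "U = ctrans g ** V" by blast
    then have "V \<in> unitary_mats"
      using sets.sets_into_space[OF assms(2)] space_mu by blast
    then show "U \<in> (\<lambda>U. g ** U) -` A \<inter> space \<mu>"
      using V g' by (auto simp: matrix_mul_assoc inv space_mu intro: unitary_mult)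
  qed
  then show ?thesis
    using haar g' assms(2) by (simp add: is_haar_unitary_def)
qed

lemma measurable_rot:
  assumes "g \<in> unitary_mats" "j < n"
  shows "rot j g \<in> measurable PP PP"
  unfolding rot_def
  by (rule measurable_fun_upd[where J = "{..<n}"])
    (use assms in \<open>auto intro!: measurable_compose[OF _ measurable_mult_left]\<close>)

text \<open>A product measure is determined by its values on boxes. The preimage of a box is a box
  in which only side \<open>j\<close> has changed, to a set of the same measure.\<close>

lemma distr_rot:
  assumes "g \<in> unitary_mats" "j < n"
  shows "distr PP PP (rot j g) = PP"
proof (rule prod.PiM_eqI)
  fix A assume A: "\<And>i. i \<in> {..<n} \<Longrightarrow> A i \<in> sets \<mu>"
  define B where "B = A(j := (\<lambda>U. g ** U) -` A j \<inter> space \<mu>)"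
  have B: "B i \<in> sets \<mu>" if "i < n" for i
    using A that assms measurable_sets[OF measurable_mult_left] by (auto simp: B_def)
  have sp: "u i \<in> A i \<Longrightarrow> i < n \<Longrightarrow> u i \<in> space \<mu>" for u i
    using A[of i] sets.sets_into_space by blast
  have "rot j g -` Pi\<^sub>E {..<n} A \<inter> space PP = Pi\<^sub>E {..<n} B"
  proof (intro equalityI subsetI)
    fix u assume u: "u \<in> rot j g -` Pi\<^sub>E {..<n} A \<inter> space PP"
    show "u \<in> Pi\<^sub>E {..<n} B"
    proof (rule PiE_I)
      fix i assume "i \<in> {..<n}"
      then have "rot j g u i \<in> A i" "u i \<in> space \<mu>"
        using u by (auto simp: space_PiM)
      then show "u i \<in> B i"
        by (auto simp: B_def rot_def split: if_splits)
    next
      fix i assume "i \<notin> {..<n}"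
      then show "u i = undefined" using u by (auto simp: space_PiM)
    qed
  next
    fix u assume u: "u \<in> Pi\<^sub>E {..<n} B"
    have "u i \<in> B i" if "i < n" for i using u that by auto
    then have "rot j g u i \<in> A i \<and> u i \<in> space \<mu>" if "i < n" for i
      using that sp by (fastforce simp: B_def rot_def split: if_splits)
    moreover have "u i = undefined" if "\<not> i < n" for i using u that by auto
    ultimately show "u \<in> rot j g -` Pi\<^sub>E {..<n} A \<inter> space PP"
      using assms(2) by (auto simp: space_PiM PiE_def extensional_def) (auto simp: rot_def)
  qed
  then have "emeasure (distr PP PP (rot j g)) (Pi\<^sub>E {..<n} A) = emeasure PP (Pi\<^sub>E {..<n} B)"
    using A assms by (subst emeasure_distr) (auto intro!: measurable_rot sets_PiM_I_finite)
  also have "\<dots> = (\<Prod>i<n. emeasure \<mu> (B i))"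
    using B by (intro prod.emeasure_PiM) auto
  also have "\<dots> = (\<Prod>i<n. emeasure \<mu> (A i))"
    using A assms by (intro prod.cong) (auto simp: B_def emeasure_vimage_mult_left)
  finally show "emeasure (distr PP PP (rot j g)) (Pi\<^sub>E {..<n} A) = (\<Prod>i<n. emeasure \<mu> (A i))" .
qed auto

lemma integral_rot:
  fixes F :: "_ \<Rightarrow> complex"
  assumes "g \<in> unitary_mats" "j < n" "F \<in> borel_measurable PP"
  shows "(\<integral>u. F (rot j g u) \<partial>PP) = (\<integral>u. F u \<partial>PP)"
  using integral_distr[OF measurable_rot[OF assms(1,2)] assms(3)] distr_rot[OF assms(1,2)] by simp

lemma rot_space:
  assumes "g \<in> unitary_mats" "j < n" "u \<in> space PP"
  shows "rot j g u \<in> space PP"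
  using measurable_space[OF measurable_rot[OF assms(1,2)] assms(3)] .

end

section \<open>First-order expansions along phase rotations\<close>

text \<open>The product rule with an explicit quadratic remainder: \<open>X\<close>,
  \<open>Y\<close> stand for values at the rotated point, \<open>x\<close>, \<open>y\<close> for
  values at the base point, \<open>x'\<close>, \<open>y'\<close> for the derivatives divided by
  \<open>\<i>\<close>.\<close>

lemma expansion_mult:
  fixes X Y x y x' y' :: complex and t :: real
  assumes t: "\<bar>t\<bar> \<le> 1"
    and Y: "cmod Y \<le> B" and x: "cmod x \<le> A" and x': "cmod x' \<le> A'" and y': "cmod y' \<le> B'"
    and dX: "cmod (X - x - \<i> * t * x') \<le> A * t\<^sup>2"
    and dY: "cmod (Y - y - \<i> * t * y') \<le> B * t\<^sup>2"
  shows "cmod (X * Y - x * y - \<i> * t * (x' * y + x * y')) \<le> (A * B + (A + A') * B + A' * B') * t\<^sup>2"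
proof -
  \<comment> \<open>First \<open>X\<close>, then \<open>Y\<close> is replaced by its expansion; the
    last term is the product of the two linear terms, with \<open>\<i>\<^sup>2 = -1\<close>.\<close>
  have eq: "X * Y - x * y - \<i> * t * (x' * y + x * y') =
      (X - x - \<i> * t * x') * Y + (x + \<i> * t * x') * (Y - y - \<i> * t * y') + - (t\<^sup>2 * x' * y')"
    by (simp add: algebra_simps power2_eq_square)
  have nonneg: "0 \<le> A" "0 \<le> B" "0 \<le> A'" "0 \<le> B'"
    using x Y x' y' norm_ge_zero by (meson order_trans)+
  have "cmod ((X - x - \<i> * t * x') * Y) \<le> (A * t\<^sup>2) * B"
    unfolding norm_mult by (intro mult_mono dX Y) (use nonneg in auto)
  moreover have "cmod (x + \<i> * t * x') \<le> A + A'"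
  proof (rule norm_triangle_le)
    have "\<bar>t\<bar> * cmod x' \<le> 1 * A'"
      using t x' by (intro mult_mono) auto
    then show "cmod x + cmod (\<i> * t * x') \<le> A + A'"
      using x by (simp add: norm_mult)
  qed
  then have "cmod ((x + \<i> * t * x') * (Y - y - \<i> * t * y')) \<le> (A + A') * (B * t\<^sup>2)"
    unfolding norm_mult by (intro mult_mono dY) (use nonneg in auto)
  moreover have "cmod (- (t\<^sup>2 * x' * y')) \<le> t\<^sup>2 * (A' * B')"
    using mult_mono[OF x' y'] nonneg
    by (auto simp: norm_mult norm_power mult.assoc intro!: mult_left_mono)
  ultimately show ?thesis
    unfolding eq
    by (intro norm_triangle_le order_trans[OF add_mono[OF norm_triangle_ineq order_refl]])
      (simp add: algebra_simps)
qed

lemma cmod_iexp_expansion: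
  shows "cmod (iexp t - 1 - \<i> * t) \<le> t\<^sup>2"
proof -
  have "cmod (iexp t - 1 - \<i> * t) \<le> t\<^sup>2 / 2"
    using iexp_approx1[of t 1] by (simp add: algebra_simps power2_eq_square)
  also have "\<dots> \<le> t\<^sup>2" by simp
  finally show ?thesis .
qed

lemma norm_integral_le:
  fixes f :: "'a \<Rightarrow> 'b::{banach,second_countable_topology}"
  assumes "integrable M f" "integrable M g" "\<And>x. x \<in> space M \<Longrightarrow> norm (f x) \<le> g x"
  shows "norm (\<integral>x. f x \<partial>M) \<le> (\<integral>x. g x \<partial>M)"
  by (rule order_trans[OF integral_norm_bound integral_mono]) (use assms in auto)

lemma borel_measurable_cnj:
  "F \<in> borel_measurable M \<Longrightarrow> (\<lambda>u. cnj (F u)) \<in> borel_measurable M"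
  by (rule measurable_compose[OF _ borel_measurable_continuous_onI]) (auto intro!: continuous_intros)

text \<open>The pairing of \<open>\<phi>\<close> with the matrix v v*, the Hermitian generator of
  \<open>phase_mat v\<close>; \<open>\<phi> i p\<close> is the coefficient of the matrix unit in
  position (i, p).\<close>

definition qform :: "complex ^ 'k \<Rightarrow> ('k \<Rightarrow> 'k \<Rightarrow> complex) \<Rightarrow> complex" where
  "qform v \<phi> = (\<Sum>i\<in>UNIV. \<Sum>p\<in>UNIV. v $ i * cnj (v $ p) * \<phi> i p)"

lemma qform_bound:
  fixes v :: "complex ^ 'k::finite"
  assumes "norm v = 1" "\<And>i p. cmod (\<phi> i p) \<le> C"
  shows "cmod (qform v \<phi>) \<le> (real CARD('k))\<^sup>2 * C"
proof -
  have v: "cmod (v $ i) \<le> 1" for i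
    using Finite_Cartesian_Product.norm_nth_le[of v i] assms(1) by simp
  have "cmod (v $ i * cnj (v $ p) * \<phi> i p) \<le> 1 * 1 * C" for i p
    unfolding norm_mult complex_mod_cnj by (intro mult_mono v assms(2)) auto
  then have "cmod (qform v \<phi>) \<le> (\<Sum>i\<in>(UNIV::'k set). \<Sum>p\<in>(UNIV::'k set). C)"
    unfolding qform_def by (intro sum_norm_le) auto
  then show ?thesis by (simp add: power2_eq_square)
qed

text \<open>Polarisation, with the test vectors \<open>e\<^sub>i\<close>, \<open>e\<^sub>i + e\<^sub>p\<close> and \<open>e\<^sub>i + \<i> e\<^sub>p\<close>.\<close>

lemma qform_zero_imp:
  fixes \<phi> :: "'k::finite \<Rightarrow> 'k \<Rightarrow> complex"
  assumes "\<And>v. norm v = 1 \<Longrightarrow> qform v \<phi> = 0"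
  shows "\<phi> i p = 0"
proof -
  \<comment> \<open>The form scales quadratically under positive real factors, so vanishing on unit
    vectors extends to all vectors.\<close>
  have q: "qform v \<phi> = 0" for v
  proof (cases "v = 0")
    case False
    have "qform (complex_of_real (inverse (norm v)) *s v) \<phi> =
        (complex_of_real (inverse (norm v)))\<^sup>2 * qform v \<phi>"
      by (simp add: qform_def sum_distrib_left algebra_simps power2_eq_square)
    moreover have "norm (complex_of_real (inverse (norm v)) *s v) = 1"
      using False by (simp add: norm_vector_smult norm_inverse)
    ultimately show ?thesis using assms False by simp
  qed (simp add: qform_def)
  have ax: "qform (axis a x) \<phi> = x * cnj x * \<phi> a a" for a x
  proof -
    have "axis a x $ b * cnj (axis a x $ c) * \<phi> b c =
        (if c = a then (if b = a then x * cnj x * \<phi> a a else 0) else 0)" for b c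
      by (simp add: axis_def)
    then show ?thesis by (simp add: qform_def)
  qed
  have diag: "\<phi> a a = 0" for a
    using ax[of a 1] q by simp
  show ?thesis
  proof (cases "i = p")
    case False
    have ax2: "qform (axis i 1 + axis p x) \<phi> =
        \<phi> i i + cnj x * \<phi> i p + x * \<phi> p i + x * cnj x * \<phi> p p" for x
    proof -
      have "(axis i 1 + axis p x) $ b * cnj ((axis i 1 + axis p x) $ c) * \<phi> b c =
        (if c = i then (if b = i then \<phi> i i else 0) else 0) +
        (if c = p then (if b = i then cnj x * \<phi> i p else 0) else 0) +
        (if c = i then (if b = p then x * \<phi> p i else 0) else 0) +
        (if c = p then (if b = p then x * cnj x * \<phi> p p else 0) else 0)" for b c
        using False by (auto simp: axis_def)
      then show ?thesis by (simp add: qform_def sum.distrib)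
    qed
    have "\<phi> i p + \<phi> p i = 0" "- \<i> * \<phi> i p + \<i> * \<phi> p i = 0"
      using ax2[of 1] ax2[of \<i>] diag by (auto simp: q)
    then show ?thesis
      by (simp add: add_eq_0_iff)
  qed (use diag in auto)
qed

section \<open>Calculus of uniform first-order expansions\<close>

context haar_power
begin

text \<open>Differentiability of \<open>F\<close> under rotations of coordinate \<open>j\<close>:
  \<open>\<i> * qform v \<phi>\<close> is the derivative at \<open>t = 0\<close>. The constant is
  uniform in \<open>u\<close> and \<open>v\<close>, and boundedness and measurability are bundled
  in, so that the expansion can be integrated.\<close>

definition taylor ::
  "nat \<Rightarrow> ((nat \<Rightarrow> 'k cmat) \<Rightarrow> complex) \<Rightarrow> ('k \<Rightarrow> 'k \<Rightarrow> (nat \<Rightarrow> 'k cmat) \<Rightarrow> complex) \<Rightarrow> bool" where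
  "taylor j F \<phi> \<longleftrightarrow> F \<in> borel_measurable PP \<and> (\<forall>i p. \<phi> i p \<in> borel_measurable PP) \<and>
     (\<exists>C. \<forall>u\<in>space PP. cmod (F u) \<le> C \<and> (\<forall>i p. cmod (\<phi> i p u) \<le> C) \<and>
        (\<forall>v t. norm v = 1 \<longrightarrow> \<bar>t\<bar> \<le> 1 \<longrightarrow>
           cmod (F (rot j (phase_mat v t) u) - F u - \<i> * t * qform v (\<lambda>i p. \<phi> i p u)) \<le> C * t\<^sup>2))"

lemma taylorI:
  assumes "F \<in> borel_measurable PP" "\<And>i p. \<phi> i p \<in> borel_measurable PP"
    and "\<And>u. u \<in> space PP \<Longrightarrow> cmod (F u) \<le> A"
    and "\<And>u i p. u \<in> space PP \<Longrightarrow> cmod (\<phi> i p u) \<le> B"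
    and "\<And>u v t. u \<in> space PP \<Longrightarrow> norm v = 1 \<Longrightarrow> \<bar>t\<bar> \<le> 1 \<Longrightarrow>
       cmod (F (rot j (phase_mat v t) u) - F u - \<i> * t * qform v (\<lambda>i p. \<phi> i p u)) \<le> D * t\<^sup>2"
  shows "taylor j F \<phi>"
proof -
  let ?C = "max A (max B D)"
  have "cmod (F (rot j (phase_mat v t) u) - F u - \<i> * t * qform v (\<lambda>i p. \<phi> i p u)) \<le> ?C * t\<^sup>2"
    if "u \<in> space PP" "norm v = 1" "\<bar>t\<bar> \<le> 1" for u v t
    by (rule order_trans[OF assms(5)[OF that]]) (auto intro: mult_right_mono)
  then show ?thesis
    unfolding taylor_def using assms(1-4)
    by (intro conjI allI exI[where x = ?C]) (auto simp: le_max_iff_disj)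
qed

lemma taylor_const: "taylor j (\<lambda>_. c) (\<lambda>_ _ _. 0)"
  by (rule taylorI[where A = "cmod c" and B = 0 and D = 0]) (auto simp: qform_def)

lemma taylor_add:
  assumes "taylor j F \<phi>" "taylor j G \<psi>"
  shows "taylor j (\<lambda>u. F u + G u) (\<lambda>i p u. \<phi> i p u + \<psi> i p u)"
proof -
  obtain A where A: "\<And>u. u \<in> space PP \<Longrightarrow> cmod (F u) \<le> A"
    "\<And>u i p. u \<in> space PP \<Longrightarrow> cmod (\<phi> i p u) \<le> A"
    "\<And>u v t. u \<in> space PP \<Longrightarrow> norm v = 1 \<Longrightarrow> \<bar>t\<bar> \<le> 1 \<Longrightarrow>
       cmod (F (rot j (phase_mat v t) u) - F u - \<i> * t * qform v (\<lambda>i p. \<phi> i p u)) \<le> A * t\<^sup>2"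
    using assms(1) unfolding taylor_def by metis
  obtain B where B: "\<And>u. u \<in> space PP \<Longrightarrow> cmod (G u) \<le> B"
    "\<And>u i p. u \<in> space PP \<Longrightarrow> cmod (\<psi> i p u) \<le> B"
    "\<And>u v t. u \<in> space PP \<Longrightarrow> norm v = 1 \<Longrightarrow> \<bar>t\<bar> \<le> 1 \<Longrightarrow>
       cmod (G (rot j (phase_mat v t) u) - G u - \<i> * t * qform v (\<lambda>i p. \<psi> i p u)) \<le> B * t\<^sup>2"
    using assms(2) unfolding taylor_def by metis
  show ?thesis
  proof (rule taylorI[where A = "A + B" and B = "A + B" and D = "A + B"])
    fix u v t assume u: "u \<in> space PP" "norm (v :: complex^'k) = 1" "\<bar>t :: real\<bar> \<le> 1"
    have q: "qform v (\<lambda>i p. \<phi> i p u + \<psi> i p u) = qform v (\<lambda>i p. \<phi> i p u) + qform v (\<lambda>i p. \<psi> i p u)"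
      by (simp add: qform_def sum.distrib algebra_simps)
    show "cmod (F (rot j (phase_mat v t) u) + G (rot j (phase_mat v t) u) - (F u + G u)
        - \<i> * t * qform v (\<lambda>i p. \<phi> i p u + \<psi> i p u)) \<le> (A + B) * t\<^sup>2"
      using norm_triangle_mono[OF A(3)[OF u] B(3)[OF u]] unfolding q
      by (simp add: algebra_simps)
  qed (use assms A B in \<open>auto simp: taylor_def intro!: norm_triangle_mono borel_measurable_add\<close>)
qed

text \<open>This is \<open>expansion_mult\<close>, with \<open>qform_bound\<close> controlling the
  derivatives. \<open>G\<close> must also be bounded at the rotated point, which stays in the space
  by \<open>rot_space\<close>.\<close>

lemma taylor_mult:
  assumes "j < n" "taylor j F \<phi>" "taylor j G \<psi>"
  shows "taylor j (\<lambda>u. F u * G u) (\<lambda>i p u. \<phi> i p u * G u + F u * \<psi> i p u)"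
proof -
  obtain A where A: "\<And>u. u \<in> space PP \<Longrightarrow> cmod (F u) \<le> A"
    "\<And>u i p. u \<in> space PP \<Longrightarrow> cmod (\<phi> i p u) \<le> A"
    "\<And>u v t. u \<in> space PP \<Longrightarrow> norm v = 1 \<Longrightarrow> \<bar>t\<bar> \<le> 1 \<Longrightarrow>
       cmod (F (rot j (phase_mat v t) u) - F u - \<i> * t * qform v (\<lambda>i p. \<phi> i p u)) \<le> A * t\<^sup>2"
    using assms(2) unfolding taylor_def by metis
  obtain B where B: "\<And>u. u \<in> space PP \<Longrightarrow> cmod (G u) \<le> B"
    "\<And>u i p. u \<in> space PP \<Longrightarrow> cmod (\<psi> i p u) \<le> B"
    "\<And>u v t. u \<in> space PP \<Longrightarrow> norm v = 1 \<Longrightarrow> \<bar>t\<bar> \<le> 1 \<Longrightarrow>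
       cmod (G (rot j (phase_mat v t) u) - G u - \<i> * t * qform v (\<lambda>i p. \<psi> i p u)) \<le> B * t\<^sup>2"
    using assms(3) unfolding taylor_def by metis
  let ?K = "(real CARD('k))\<^sup>2"
  have bound2: "cmod (x * y) \<le> A * B" if "cmod x \<le> A" "cmod y \<le> B" for x y
    unfolding norm_mult
    by (intro mult_mono that norm_ge_zero order_trans[OF norm_ge_zero that(1)])
  show ?thesis
  proof (rule taylorI[where A = "A * B" and B = "A * B + A * B"
        and D = "A * B + (A + ?K * A) * B + (?K * A) * (?K * B)"])
    fix u v t assume u: "u \<in> space PP" and v: "norm (v :: complex^'k) = 1" and t: "\<bar>t :: real\<bar> \<le> 1"
    have q: "qform v (\<lambda>i p. \<phi> i p u * G u + F u * \<psi> i p u) =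
        qform v (\<lambda>i p. \<phi> i p u) * G u + F u * qform v (\<lambda>i p. \<psi> i p u)"
      by (simp add: qform_def sum.distrib sum_distrib_left sum_distrib_right algebra_simps)
    have u': "rot j (phase_mat v t) u \<in> space PP"
      by (rule rot_space[OF phase_mat_unitary[OF v] assms(1) u])
    show "cmod (F (rot j (phase_mat v t) u) * G (rot j (phase_mat v t) u) - F u * G u
        - \<i> * t * qform v (\<lambda>i p. \<phi> i p u * G u + F u * \<psi> i p u))
        \<le> (A * B + (A + ?K * A) * B + (?K * A) * (?K * B)) * t\<^sup>2"
      unfolding q
      by (rule expansion_mult[OF t B(1)[OF u'] A(1)[OF u] _ _ A(3)[OF u v t] B(3)[OF u v t]])
        (auto intro!: qform_bound v A B u)
  next
    fix u i p assume u: "u \<in> space PP"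
    show "cmod (\<phi> i p u * G u + F u * \<psi> i p u) \<le> A * B + A * B"
      by (intro norm_triangle_mono bound2 A B u)
  qed (use assms A B in \<open>auto simp: taylor_def intro!: bound2 borel_measurable_add borel_measurable_times\<close>)
qed

lemma taylor_sum:
  assumes "finite I" "\<And>x. x \<in> I \<Longrightarrow> taylor j (F x) (\<phi> x)"
  shows "taylor j (\<lambda>u. \<Sum>x\<in>I. F x u) (\<lambda>i p u. \<Sum>x\<in>I. \<phi> x i p u)"
  using assms by (induction I rule: finite_induct) (auto intro!: taylor_const taylor_add)

text \<open>Conjugation turns the factor \<i> into -\<i>, hence the sign, and replaces v v* by its
  transpose, hence the exchanged indices.\<close>

lemma taylor_cnj:
  assumes "taylor j F \<phi>"
  shows "taylor j (\<lambda>u. cnj (F u)) (\<lambda>i p u. - cnj (\<phi> p i u))"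
proof -
  obtain A where A: "\<And>u. u \<in> space PP \<Longrightarrow> cmod (F u) \<le> A"
    "\<And>u i p. u \<in> space PP \<Longrightarrow> cmod (\<phi> i p u) \<le> A"
    "\<And>u v t. u \<in> space PP \<Longrightarrow> norm v = 1 \<Longrightarrow> \<bar>t\<bar> \<le> 1 \<Longrightarrow>
       cmod (F (rot j (phase_mat v t) u) - F u - \<i> * t * qform v (\<lambda>i p. \<phi> i p u)) \<le> A * t\<^sup>2"
    using assms(1) unfolding taylor_def by metis
  show ?thesis
  proof (rule taylorI[where A = A and B = A and D = A])
    fix u v t assume u: "u \<in> space PP" "norm (v :: complex^'k) = 1" "\<bar>t :: real\<bar> \<le> 1"
    have q: "qform v (\<lambda>i p. - cnj (\<phi> p i u)) = - cnj (qform v (\<lambda>i p. \<phi> i p u))"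
      unfolding qform_def cnj_sum by (subst sum.swap) (simp add: sum_negf mult.commute mult.left_commute)
    have "cmod (cnj (F (rot j (phase_mat v t) u) - F u - \<i> * t * qform v (\<lambda>i p. \<phi> i p u))) \<le> A * t\<^sup>2"
      using A(3)[OF u] by (simp only: complex_mod_cnj)
    then show "cmod (cnj (F (rot j (phase_mat v t) u)) - cnj (F u)
        - \<i> * t * qform v (\<lambda>i p. - cnj (\<phi> p i u))) \<le> A * t\<^sup>2"
      unfolding q by simp
  qed (use assms A in \<open>auto simp: taylor_def intro!: borel_measurable_cnj\<close>)
qed

lemma taylor_integrable:
  assumes "taylor j F \<phi>"
  shows "integrable PP F" "integrable PP (\<phi> i p)"
proof -
  obtain C where "\<And>u. u \<in> space PP \<Longrightarrow> cmod (F u) \<le> C"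
    "\<And>u. u \<in> space PP \<Longrightarrow> cmod (\<phi> i p u) \<le> C"
    using assms unfolding taylor_def by metis
  then show "integrable PP F" "integrable PP (\<phi> i p)"
    using assms unfolding taylor_def
    by (auto intro!: prod.integrable_const_bound[where B = C])
qed

text \<open>Invariance in infinitesimal form. The means of \<open>F\<close> before and after the
  rotation agree, so integrating the expansion leaves t |q| \<le> C t^2, where q is the mean of the
  quadratic form. Letting t tend to 0 gives q = 0 for every unit vector, and
  \<open>qform_zero_imp\<close> finishes.\<close>

lemma taylor_mean_zero:
  assumes j: "j < n" and T: "taylor j F \<phi>"
  shows "(\<integral>u. \<phi> i p u \<partial>PP) = 0"
proof (rule qform_zero_imp)
  fix v :: "complex ^ 'k" assume v: "norm v = 1"
  obtain C where C: "\<And>u t. u \<in> space PP \<Longrightarrow> \<bar>t\<bar> \<le> 1 \<Longrightarrow>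
       cmod (F (rot j (phase_mat v t) u) - F u - \<i> * t * qform v (\<lambda>i p. \<phi> i p u)) \<le> C * t\<^sup>2"
    using T v unfolding taylor_def by metis
  let ?q = "qform v (\<lambda>i p. \<integral>u. \<phi> i p u \<partial>PP)"
  have F: "F \<in> borel_measurable PP" "integrable PP F"
    using T taylor_integrable[OF T] by (auto simp: taylor_def)
  have intq: "integrable PP (\<lambda>u. qform v (\<lambda>i p. \<phi> i p u))"
    unfolding qform_def by (intro Bochner_Integration.integrable_sum integrable_mult_right taylor_integrable[OF T])
  have q: "(\<integral>u. qform v (\<lambda>i p. \<phi> i p u) \<partial>PP) = ?q"
    unfolding qform_def
    by (simp add: Bochner_Integration.integral_sum taylor_integrable[OF T] Bochner_Integration.integrable_sum)
  have le: "cmod ?q \<le> C * t" if t: "0 < t" "t \<le> 1" for t :: real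
  proof -
    let ?g = "phase_mat v t"
    have g: "?g \<in> unitary_mats" by (rule phase_mat_unitary[OF v])
    have Fr: "integrable PP (\<lambda>u. F (rot j ?g u))"
      using integrable_distr[OF measurable_rot[OF g j], of F] distr_rot[OF g j] F by simp
    have "(\<integral>u. F (rot j ?g u) - F u - \<i> * t * qform v (\<lambda>i p. \<phi> i p u) \<partial>PP) = - (\<i> * t * ?q)"
      using Fr F intq integral_rot[OF g j F(1)] q
      by (simp add: Bochner_Integration.integral_diff Bochner_Integration.integrable_diff)
    moreover have "cmod (\<integral>u. F (rot j ?g u) - F u - \<i> * t * qform v (\<lambda>i p. \<phi> i p u) \<partial>PP) \<le> (\<integral>u. C * t\<^sup>2 \<partial>PP)"
      by (intro norm_integral_le Bochner_Integration.integrable_diff integrable_mult_right Fr F intq)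
        (use C t in auto)
    ultimately have "t * cmod ?q \<le> t * (C * t)"
      using t by (simp add: norm_mult measure_space_PP power2_eq_square algebra_simps)
    then show ?thesis using t by simp
  qed
  have "cmod ?q \<le> 0"
  proof (rule tendsto_lowerbound)
    show "((\<lambda>t. C * t) \<longlongrightarrow> 0) (at_right 0)"
      by real_asymp
    show "\<forall>\<^sub>F t in at_right 0. cmod ?q \<le> C * t"
      unfolding eventually_at_right_field using le by (intro exI[of _ 1]) auto
  qed auto
  then show "?q = 0" by simp
qed

end

section \<open>Words in unitaries and constant matrices\<close>

text \<open>Inverse letters are read as adjoints, whose entries are conjugated entries of the
  generator and hence covered by \<open>taylor_cnj\<close>.\<close>

definition lett :: "nat \<times> bool \<Rightarrow> (nat \<Rightarrow> 'k::finite cmat) \<Rightarrow> 'k cmat" where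
  "lett l u = (if snd l then ctrans (u (fst l)) else u (fst l))"

text \<open>Under \<open>u j \<mapsto> g ** u j\<close> a letter \<open>u j\<close> is modified on its left and an inverse letter on its
  right; \<open>lpre\<close> and \<open>lsuf\<close> are the parts of the letter before and after that place.\<close>

definition lpre :: "nat \<times> bool \<Rightarrow> (nat \<Rightarrow> 'k::finite cmat) \<Rightarrow> 'k cmat" where
  "lpre l u = (if snd l then lett l u else mat 1)"

definition lsuf :: "nat \<times> bool \<Rightarrow> (nat \<Rightarrow> 'k::finite cmat) \<Rightarrow> 'k cmat" where
  "lsuf l u = (if snd l then mat 1 else lett l u)"

text \<open>The sign of the derivative: an inverse letter picks up the phase exp (- i t), and
  letters over other generators do not move.\<close>

definition lsgn :: "nat \<Rightarrow> nat \<times> bool \<Rightarrow> complex" where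
  "lsgn j l = (if fst l = j then (if snd l then - 1 else 1) else 0)"

primrec weval :: "((nat \<times> bool) \<times> 'k::finite cmat) list \<Rightarrow> (nat \<Rightarrow> 'k cmat) \<Rightarrow> 'k cmat" where
  "weval [] u = mat 1"
| "weval (x # W) u = lett (fst x) u ** snd x ** weval W u"

lemma weval_append: "weval (V @ W) u = weval V u ** weval W u"
  by (induction V) (auto simp: matrix_mul_assoc)

text \<open>\<open>wleft W s u ** wright W s u\<close> is \<open>weval W u\<close>, cut at the place
  where the rotation acts on letter \<open>s\<close>.\<close>

definition wleft :: "((nat \<times> bool) \<times> 'k::finite cmat) list \<Rightarrow> nat \<Rightarrow> (nat \<Rightarrow> 'k cmat) \<Rightarrow> 'k cmat" where
  "wleft W s u = weval (take s W) u ** lpre (fst (W ! s)) u"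

definition wright :: "((nat \<times> bool) \<times> 'k::finite cmat) list \<Rightarrow> nat \<Rightarrow> (nat \<Rightarrow> 'k cmat) \<Rightarrow> 'k cmat" where
  "wright W s u = lsuf (fst (W ! s)) u ** snd (W ! s) ** weval (drop (Suc s) W) u"

text \<open>The Leibniz rule for a word: its derivative in direction E is the sum of sign * left * E
  * right over these triples. Letters over other generators stay in the list with sign 0.\<close>

definition splits where
  "splits j W = map (\<lambda>s. (lsgn j (fst (W ! s)), wleft W s, wright W s)) [0..<length W]"

lemma cmod_lsgn_le: "cmod (lsgn j l) \<le> 1"
  by (simp add: lsgn_def)

definition wordn :: "nat \<Rightarrow> ((nat \<times> bool) \<times> 'k::finite cmat) list \<Rightarrow> bool" where
  "wordn n W \<longleftrightarrow> (\<forall>x\<in>set W. fst (fst x) < n \<and> mbound 1 (snd x))"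

section \<open>Measurable families of contractions and the derivatives of words\<close>

context haar_power
begin

definition mfun :: "((nat \<Rightarrow> 'k cmat) \<Rightarrow> 'k cmat) \<Rightarrow> bool" where
  "mfun Z \<longleftrightarrow> (\<forall>a b. (\<lambda>u. Z u $ a $ b) \<in> borel_measurable PP) \<and> (\<forall>u\<in>space PP. mbound 1 (Z u))"

lemma mfun_const: "mbound 1 c \<Longrightarrow> mfun (\<lambda>_. c)"
  by (simp add: mfun_def)

lemma mfun_mult: "mfun Z \<Longrightarrow> mfun Y \<Longrightarrow> mfun (\<lambda>u. Z u ** Y u)"
  by (auto simp: mfun_def matrix_matrix_mult_def mbound_mult1[unfolded matrix_matrix_mult_def]
      intro!: borel_measurable_sum borel_measurable_times)

lemma mfun_lett:
  assumes "fst l < n"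
  shows "mfun (lett l)"
proof -
  have "mbound 1 (u (fst l))" if "u \<in> space PP" for u
    by (intro mbound_unitary space_PP_unitary that assms)
  then show ?thesis
    using measurable_entry[OF assms] unfolding mfun_def lett_def
    by (cases "snd l") (auto intro!: borel_measurable_cnj mbound_ctrans)
qed

lemma mfun_weval: "wordn n W \<Longrightarrow> mfun (weval W)"
proof (induction W)
  case Nil
  then show ?case using mfun_const[of "mat 1"] by (simp add: mfun_def)
next
  case (Cons x W)
  then have "mfun (\<lambda>u. lett (fst x) u ** snd x ** weval W u)"
    by (intro mfun_mult mfun_lett mfun_const) (auto simp: wordn_def)
  then show ?case by (simp add: mfun_def)
qed

lemma mfun_lpre: "fst l < n \<Longrightarrow> mfun (lpre l)"
  unfolding lpre_def by (cases "snd l") (auto intro: mfun_lett mfun_const)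

lemma mfun_lsuf: "fst l < n \<Longrightarrow> mfun (lsuf l)"
  unfolding lsuf_def by (cases "snd l") (auto intro: mfun_lett mfun_const)

lemma wordn_take: "wordn n W \<Longrightarrow> wordn n (take s W)"
  and wordn_drop: "wordn n W \<Longrightarrow> wordn n (drop s W)"
  by (auto simp: wordn_def dest: in_set_takeD in_set_dropD)

lemma mfun_wleft: "wordn n W \<Longrightarrow> s < length W \<Longrightarrow> mfun (wleft W s)"
  unfolding wleft_def
  by (intro mfun_mult mfun_weval wordn_take mfun_lpre) (auto simp: wordn_def)

lemma mfun_wright: "wordn n W \<Longrightarrow> s < length W \<Longrightarrow> mfun (wright W s)"
  unfolding wright_def
  by (intro mfun_mult mfun_weval wordn_drop mfun_lsuf mfun_const) (auto simp: wordn_def)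

lemma mfun_trace_measurable: "mfun Z \<Longrightarrow> (\<lambda>u. trace (Z u)) \<in> borel_measurable PP"
  unfolding mfun_def trace_def by (intro borel_measurable_sum) auto

lemma mfun_ntrace_measurable: "mfun Z \<Longrightarrow> (\<lambda>u. ntrace (Z u)) \<in> borel_measurable PP"
  unfolding ntrace_def by (auto dest: mfun_trace_measurable)

lemma mfun_ntrace_le: "mfun Z \<Longrightarrow> u \<in> space PP \<Longrightarrow> cmod (ntrace (Z u)) \<le> 1"
  by (auto simp: mfun_def intro: cmod_ntrace_le)

text \<open>The derivative of \<open>Z\<close> in the direction of the matrix unit E in position (i,
  p) is the sum of \<sigma> L E R; the formula is its (a, b) entry. Keeping \<open>L\<close> and
  \<open>R\<close> apart is what later produces a product of two traces.\<close>

definition mder ::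
  "nat \<Rightarrow> ((nat \<Rightarrow> 'k cmat) \<Rightarrow> 'k cmat) \<Rightarrow>
   (complex \<times> ((nat \<Rightarrow> 'k cmat) \<Rightarrow> 'k cmat) \<times> ((nat \<Rightarrow> 'k cmat) \<Rightarrow> 'k cmat)) list \<Rightarrow> bool" where
  "mder j Z S \<longleftrightarrow>
     (\<forall>a b. taylor j (\<lambda>u. Z u $ a $ b) (\<lambda>i p u. \<Sum>(\<sigma>, L, R)\<leftarrow>S. \<sigma> * L u $ a $ i * R u $ p $ b))"

lemma mder_const: "mder j (\<lambda>_. c) []"
  by (simp add: mder_def taylor_const)

text \<open>The undifferentiated factor is attached to the right part of each cut of
  \<open>Z\<close>, or to the left part of each cut of \<open>Y\<close>.\<close>

lemma mder_mult:
  assumes "j < n" "mder j Z S" "mder j Y T"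
  shows "mder j (\<lambda>u. Z u ** Y u)
    (map (\<lambda>(\<sigma>, L, R). (\<sigma>, L, \<lambda>u. R u ** Y u)) S @ map (\<lambda>(\<sigma>, L, R). (\<sigma>, \<lambda>u. Z u ** L u, R)) T)"
  unfolding mder_def
proof (intro allI)
  fix a b
  have "taylor j (\<lambda>u. \<Sum>c\<in>UNIV. Z u $ a $ c * Y u $ c $ b)
     (\<lambda>i p u. \<Sum>c\<in>UNIV. (\<Sum>(\<sigma>, L, R)\<leftarrow>S. \<sigma> * L u $ a $ i * R u $ p $ c) * Y u $ c $ b +
        Z u $ a $ c * (\<Sum>(\<sigma>, L, R)\<leftarrow>T. \<sigma> * L u $ c $ i * R u $ p $ b))"
    using assms unfolding mder_def by (intro taylor_sum taylor_mult) auto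
  moreover have "(\<Sum>c\<in>UNIV. (\<Sum>(\<sigma>, L, R)\<leftarrow>S. \<sigma> * L u $ a $ i * R u $ p $ c) * Y u $ c $ b) =
      (\<Sum>(\<sigma>, L, R)\<leftarrow>map (\<lambda>(\<sigma>, L, R). (\<sigma>, L, \<lambda>u. R u ** Y u)) S. \<sigma> * L u $ a $ i * R u $ p $ b)"
    for i p u
    by (induction S)
      (auto simp: matrix_matrix_mult_def sum.distrib sum_distrib_left sum_distrib_right algebra_simps)
  moreover have "(\<Sum>c\<in>UNIV. Z u $ a $ c * (\<Sum>(\<sigma>, L, R)\<leftarrow>T. \<sigma> * L u $ c $ i * R u $ p $ b)) =
      (\<Sum>(\<sigma>, L, R)\<leftarrow>map (\<lambda>(\<sigma>, L, R). (\<sigma>, \<lambda>u. Z u ** L u, R)) T. \<sigma> * L u $ a $ i * R u $ p $ b)"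
    for i p u
    by (induction T)
      (auto simp: matrix_matrix_mult_def sum.distrib sum_distrib_left sum_distrib_right algebra_simps)
  ultimately show "taylor j (\<lambda>u. (Z u ** Y u) $ a $ b)
     (\<lambda>i p u. \<Sum>(\<sigma>, L, R)\<leftarrow>map (\<lambda>(\<sigma>, L, R). (\<sigma>, L, \<lambda>u. R u ** Y u)) S @
         map (\<lambda>(\<sigma>, L, R). (\<sigma>, \<lambda>u. Z u ** L u, R)) T. \<sigma> * L u $ a $ i * R u $ p $ b)"
    by (simp add: matrix_matrix_mult_def sum.distrib del: map_map)
qed

text \<open>By \<open>phase_mat_mult\<close> the remainder is exactly
  \<open>iexp t - 1 - \<i> * t\<close> times the quadratic form.\<close>

lemma taylor_entry:
  assumes "j < n"
  shows "taylor j (\<lambda>u. u j $ a $ b) (\<lambda>i p u. mat 1 $ a $ i * u j $ p $ b)"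
proof (rule taylorI[where A = 1 and B = 1 and D = "(real CARD('k))\<^sup>2 * 1"])
  have U: "cmod (u j $ c $ d) \<le> 1" if "u \<in> space PP" for u c d
    using that assms by (intro cmod_entry_le mbound_unitary space_PP_unitary)
  show "cmod (u j $ a $ b) \<le> 1" if "u \<in> space PP" for u
    by (rule U[OF that])
  show B: "cmod (mat 1 $ a $ i * u j $ p $ b) \<le> 1" if "u \<in> space PP" for u i p
    using U[OF that] by (simp add: mat_def)
  fix u v t assume u: "u \<in> space PP" and v: "norm (v :: complex^'k) = 1" and t: "\<bar>t :: real\<bar> \<le> 1"
  let ?q = "qform v (\<lambda>i p. mat 1 $ a $ i * u j $ p $ b)"
  have "?q = (\<Sum>i\<in>UNIV. if a = i then \<Sum>p\<in>UNIV. v $ i * cnj (v $ p) * u j $ p $ b else 0)"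
    unfolding qform_def by (rule sum.cong) (auto simp: mat_def)
  then have "?q = (\<Sum>p\<in>UNIV. v $ a * cnj (v $ p) * u j $ p $ b)"
    by simp
  then have "rot j (phase_mat v t) u j $ a $ b - u j $ a $ b - \<i> * t * ?q = (iexp t - 1 - \<i> * t) * ?q"
    by (simp add: rot_def phase_mat_mult algebra_simps)
  also have "cmod \<dots> \<le> t\<^sup>2 * ((real CARD('k))\<^sup>2 * 1)"
    unfolding norm_mult by (intro mult_mono cmod_iexp_expansion qform_bound v B u) auto
  finally show "cmod (rot j (phase_mat v t) u j $ a $ b - u j $ a $ b - \<i> * t * ?q)
      \<le> (real CARD('k))\<^sup>2 * 1 * t\<^sup>2"
    by (simp add: mult.commute)
qed (use assms measurable_entry in \<open>auto intro!: borel_measurable_times\<close>)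

text \<open>A generator other than \<open>j\<close> stays fixed. An inverse letter is a transposed
  and conjugated generator, so \<open>taylor_cnj\<close> supplies the sign and moves the cut from
  its left to its right.\<close>

lemma mder_lett:
  assumes "j < n" "fst l < n"
  shows "mder j (lett l) [(lsgn j l, lpre l, lsuf l)]"
  unfolding mder_def
proof (intro allI)
  fix a b
  show "taylor j (\<lambda>u. lett l u $ a $ b)
     (\<lambda>i p u. \<Sum>(\<sigma>, L, R)\<leftarrow>[(lsgn j l, lpre l, lsuf l)]. \<sigma> * L u $ a $ i * R u $ p $ b)"
  proof (cases "fst l = j")
    case False
    have "taylor j (\<lambda>u. lett l u $ a $ b) (\<lambda>i p u. 0)"
    proof (rule taylorI[where A = 1 and B = 0 and D = 0])
      show "cmod (lett l u $ a $ b) \<le> 1" if "u \<in> space PP" for u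
        using mfun_lett[OF assms(2)] that by (auto simp: mfun_def intro: cmod_entry_le)
    qed (use False mfun_lett[OF assms(2)] in \<open>auto simp: mfun_def lett_def rot_def qform_def\<close>)
    then show ?thesis using False by (simp add: lsgn_def)
  next
    case True
    show ?thesis
    proof (cases "snd l")
      case F: False
      show ?thesis
        using taylor_entry[OF assms(1), of a b] True F by (simp add: lsgn_def lett_def lpre_def lsuf_def)
    next
      case T: True
      have "cnj ((mat 1 :: 'k cmat) $ b $ p) = mat 1 $ p $ b" for p
        by (simp add: mat_def)
      then show ?thesis
        using taylor_cnj[OF taylor_entry[OF assms(1), of b a]] True T
        by (simp add: lsgn_def lett_def lpre_def lsuf_def mult.commute)
    qed
  qed
qed

lemma mder_weval:
  assumes "j < n" "wordn n W"
  shows "mder j (weval W) (splits j W)"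
  using assms(2)
proof (induction W)
  case Nil
  then show ?case using mder_const[of j "mat 1"] by (simp add: splits_def)
next
  case (Cons x W)
  have IH: "mder j (weval W) (splits j W)" and l: "fst (fst x) < n"
    using Cons by (auto simp: wordn_def)
  have "mder j (weval (x # W)) ((lsgn j (fst x), lpre (fst x), \<lambda>u. lsuf (fst x) u ** snd x ** weval W u) #
      map (\<lambda>(\<sigma>, L, R). (\<sigma>, \<lambda>u. lett (fst x) u ** snd x ** L u, R)) (splits j W))"
    using mder_mult[OF assms(1) mder_mult[OF assms(1) mder_lett[OF assms(1) l] mder_const[of j "snd x"]] IH]
    by (simp add: mder_def)
  \<comment> \<open>Prepending a letter adds the cut at position 0, shifts the old cuts by one and
    multiplies their left parts by the letter and its constant.\<close>
  moreover have "(lsgn j (fst x), lpre (fst x), \<lambda>u. lsuf (fst x) u ** snd x ** weval W u) #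
      map (\<lambda>(\<sigma>, L, R). (\<sigma>, \<lambda>u. lett (fst x) u ** snd x ** L u, R)) (splits j W) = splits j (x # W)"
  proof -
    have "splits j (x # W) = (lsgn j (fst x), wleft (x # W) 0, wright (x # W) 0) #
      map (\<lambda>s. (lsgn j (fst (W ! s)), wleft (x # W) (Suc s), wright (x # W) (Suc s))) [0..<length W]"
      unfolding splits_def by (simp add: upt_conv_Cons map_Suc_upt[symmetric] del: upt_Suc)
    then show ?thesis
      by (simp add: splits_def wleft_def[abs_def] wright_def[abs_def] matrix_mul_assoc)
  qed
  ultimately show ?case by (simp only:)
qed

section \<open>The loop equation\<close>

text \<open>\<open>taylor_mean_zero\<close> is applied to entry (a, b) of \<open>Z\<close> times
  \<open>H\<close>, with the component (a, b) of its derivative, and summed over a and b. The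
  diagonal entries of \<open>L\<close> and \<open>R\<close> then add up to separate traces. The
  gradient of \<open>H\<close> is stored transposed, so that the other sum is a trace of
  \<open>Z u ** G u\<close>.\<close>

lemma loop_equation:
  assumes j: "j < n" and Z: "mder j Z S" and H: "taylor j H (\<lambda>i p u. G u $ p $ i)"
  shows "(\<integral>u. (\<Sum>(\<sigma>, L, R)\<leftarrow>S. \<sigma> * trace (L u) * trace (R u)) * H u + trace (Z u ** G u) \<partial>PP) = 0"
proof -
  define f where "f a b u = (\<Sum>(\<sigma>, L, R)\<leftarrow>S. \<sigma> * L u $ a $ a * R u $ b $ b) * H u + Z u $ a $ b * G u $ b $ a" for a b u
  have T: "taylor j (\<lambda>u. Z u $ a $ b * H u)
     (\<lambda>i p u. (\<Sum>(\<sigma>, L, R)\<leftarrow>S. \<sigma> * L u $ a $ i * R u $ p $ b) * H u + Z u $ a $ b * G u $ p $ i)" for a b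
    by (rule taylor_mult[OF j Z[unfolded mder_def, rule_format] H])
  have f: "(\<integral>u. f a b u \<partial>PP) = 0" "integrable PP (f a b)" for a b
    using taylor_mean_zero[OF j T[of a b], of a b] taylor_integrable(2)[OF T[of a b], of a b] by (simp_all add: f_def[abs_def])
  have "(\<Sum>a\<in>UNIV. \<Sum>b\<in>UNIV. (\<Sum>(\<sigma>, L, R)\<leftarrow>S. \<sigma> * L u $ a $ a * R u $ b $ b)) =
      (\<Sum>(\<sigma>, L, R)\<leftarrow>S. \<sigma> * trace (L u) * trace (R u))" for u
  proof (induction S)
    case (Cons x S)
    then show ?case
    proof (cases x)
      case (fields \<sigma> L R)
      have "(\<Sum>a\<in>UNIV. \<Sum>b\<in>UNIV. \<sigma> * L u $ a $ a * R u $ b $ b) = \<sigma> * trace (L u) * trace (R u)"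
        unfolding trace_def mult.assoc sum_product by (simp only: sum_distrib_left)
      then show ?thesis using Cons fields by (simp add: sum.distrib)
    qed
  qed simp
  note S = this
  have "(\<Sum>a\<in>UNIV. \<Sum>b\<in>UNIV. f a b u) =
      (\<Sum>(\<sigma>, L, R)\<leftarrow>S. \<sigma> * trace (L u) * trace (R u)) * H u + trace (Z u ** G u)" for u
  proof -
    have "(\<Sum>a\<in>UNIV. \<Sum>b\<in>UNIV. f a b u) =
        (\<Sum>a\<in>UNIV. \<Sum>b\<in>UNIV. (\<Sum>(\<sigma>, L, R)\<leftarrow>S. \<sigma> * L u $ a $ a * R u $ b $ b)) * H u +
        (\<Sum>a\<in>UNIV. \<Sum>b\<in>UNIV. Z u $ a $ b * G u $ b $ a)"
      by (simp add: f_def sum.distrib sum_distrib_right)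
    moreover have "trace (Z u ** G u) = (\<Sum>a\<in>UNIV. \<Sum>b\<in>UNIV. Z u $ a $ b * G u $ b $ a)"
      by (simp add: trace_def matrix_matrix_mult_def)
    ultimately show ?thesis
      unfolding S by (simp only:)
  qed
  note this[symmetric]
  then have "(\<integral>u. (\<Sum>(\<sigma>, L, R)\<leftarrow>S. \<sigma> * trace (L u) * trace (R u)) * H u + trace (Z u ** G u) \<partial>PP) =
      (\<integral>u. (\<Sum>a\<in>UNIV. \<Sum>b\<in>UNIV. f a b u) \<partial>PP)"
    by (simp only:)
  also have "\<dots> = 0"
    using f by (simp add: Bochner_Integration.integral_sum Bochner_Integration.integrable_sum)
  finally show ?thesis .
qed

text \<open>The functions that may stand beside the trace in the loop equation. \<open>N\<close>
  bounds the number of letters in the normalized traces whose product is \<open>H\<close>; each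
  letter contributes at most 1/k to the norm of the gradient \<open>G\<close>.\<close>

definition obs :: "nat \<Rightarrow> ((nat \<Rightarrow> 'k cmat) \<Rightarrow> complex) \<Rightarrow> bool" where
  "obs N H \<longleftrightarrow> H \<in> borel_measurable PP \<and> (\<forall>u\<in>space PP. cmod (H u) \<le> 1) \<and>
     (\<forall>j<n. \<exists>G. (\<forall>u\<in>space PP. mbound (real N / real CARD('k)) (G u)) \<and>
        taylor j H (\<lambda>i p u. G u $ p $ i))"

lemma obsI:
  assumes "H \<in> borel_measurable PP" "\<And>u. u \<in> space PP \<Longrightarrow> cmod (H u) \<le> 1"
    and "\<And>j. j < n \<Longrightarrow> \<exists>G. (\<forall>u\<in>space PP. mbound (real N / real CARD('k)) (G u)) \<and>
        taylor j H (\<lambda>i p u. G u $ p $ i)"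
  shows "obs N H"
  using assms unfolding obs_def by blast

lemma obsD:
  assumes "obs N H"
  shows "H \<in> borel_measurable PP" "u \<in> space PP \<Longrightarrow> cmod (H u) \<le> 1"
  using assms unfolding obs_def by blast+

lemma obs_one: "obs 0 (\<lambda>_. 1)"
proof (rule obsI)
  show "\<exists>G. (\<forall>u\<in>space PP. mbound (real 0 / real CARD('k)) (G u)) \<and>
        taylor j (\<lambda>_. 1) (\<lambda>i p u. G u $ p $ i)" for j
    using taylor_const[of j 1] by (intro exI[of _ "\<lambda>_. 0"]) simp
qed auto

text \<open>Leibniz rule; both factors have modulus at most 1, so the gradient bounds add.\<close>

lemma obs_mult:
  assumes "obs N H" "obs N' H'"
  shows "obs (N + N') (\<lambda>u. H u * H' u)"
proof -
  have "\<exists>K. (\<forall>u\<in>space PP. mbound (real (N + N') / real CARD('k)) (K u)) \<and>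
      taylor j (\<lambda>u. H u * H' u) (\<lambda>i p u. K u $ p $ i)" if j: "j < n" for j
  proof -
    obtain G where G: "\<And>u. u \<in> space PP \<Longrightarrow> mbound (real N / real CARD('k)) (G u)"
      "taylor j H (\<lambda>i p u. G u $ p $ i)"
      using assms(1) j unfolding obs_def by metis
    obtain G' where G': "\<And>u. u \<in> space PP \<Longrightarrow> mbound (real N' / real CARD('k)) (G' u)"
      "taylor j H' (\<lambda>i p u. G' u $ p $ i)"
      using assms(2) j unfolding obs_def by metis
    define K where "K u = smat (H' u) (G u) + smat (H u) (G' u)" for u
    have "mbound (real (N + N') / real CARD('k)) (K u)" if u: "u \<in> space PP" for u
    proof (rule mbound_mono)
      show "mbound (cmod (H' u) * (real N / real CARD('k)) + cmod (H u) * (real N' / real CARD('k))) (K u)"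
        unfolding K_def by (intro mbound_add mbound_smat G G' u)
      have "cmod (H' u) * (real N / real CARD('k)) + cmod (H u) * (real N' / real CARD('k))
          \<le> 1 * (real N / real CARD('k)) + 1 * (real N' / real CARD('k))"
        by (intro add_mono mult_right_mono obsD[OF assms(1)] obsD[OF assms(2)] u) auto
      then show "cmod (H' u) * (real N / real CARD('k)) + cmod (H u) * (real N' / real CARD('k))
          \<le> real (N + N') / real CARD('k)"
        by (simp add: add_divide_distrib)
    qed
    moreover have "taylor j (\<lambda>u. H u * H' u) (\<lambda>i p u. K u $ p $ i)"
      using taylor_mult[OF j G(2) G'(2)] by (simp add: K_def mult.commute)
    ultimately show ?thesis by blast
  qed
  then show ?thesis
    by (rule obsI[rotated 2]) (use obsD[OF assms(1)] obsD[OF assms(2)] in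
      \<open>auto simp: norm_mult intro!: mult_le_one borel_measurable_times\<close>)
qed

lemma obs_cnj:
  assumes "obs N H"
  shows "obs N (\<lambda>u. cnj (H u))"
proof -
  have "\<exists>K. (\<forall>u\<in>space PP. mbound (real N / real CARD('k)) (K u)) \<and>
      taylor j (\<lambda>u. cnj (H u)) (\<lambda>i p u. K u $ p $ i)" if j: "j < n" for j
  proof -
    obtain G where G: "\<And>u. u \<in> space PP \<Longrightarrow> mbound (real N / real CARD('k)) (G u)"
      "taylor j H (\<lambda>i p u. G u $ p $ i)"
      using assms(1) j unfolding obs_def by metis
    have "mbound (real N / real CARD('k)) (smat (- 1) (ctrans (G u)))" if "u \<in> space PP" for u
      using mbound_smat[OF mbound_ctrans[OF G(1)[OF that]], where c = "- 1"]
      by (simp only: norm_minus_cancel norm_one mult_1 divide_nonneg_nonneg of_nat_0_le_iff)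
    moreover have "taylor j (\<lambda>u. cnj (H u)) (\<lambda>i p u. smat (- 1) (ctrans (G u)) $ p $ i)"
      using taylor_cnj[OF G(2)] by (simp only: smat_nth ctrans_nth mult_minus1)
    ultimately show ?thesis
      by (intro exI[of _ "\<lambda>u. smat (- 1) (ctrans (G u))"] conjI ballI)
  qed
  then show ?thesis
    by (intro obsI borel_measurable_cnj obsD(1)[OF assms]) (simp_all add: obsD(2)[OF assms])
qed

text \<open>Differentiating letter \<open>s\<close> and closing the trace cyclically gives, up to
  sign, the contraction right ** c ** left as gradient. There is one such term per letter, and the
  normalisation of the trace gives 1/k.\<close>

lemma obs_word:
  assumes W: "wordn n W" and c: "mbound 1 c"
  shows "obs (length W) (\<lambda>u. ntrace (weval W u ** c))"
proof -
  have "\<exists>K. (\<forall>u\<in>space PP. mbound (real (length W) / real CARD('k)) (K u)) \<and>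
      taylor j (\<lambda>u. ntrace (weval W u ** c)) (\<lambda>i p u. K u $ p $ i)" if j: "j < n" for j
  proof -
    let ?k = "of_nat CARD('k) :: complex"
    let ?\<sigma> = "\<lambda>s. lsgn j (fst (W ! s))"
    let ?M = "\<lambda>s u. wright W s u ** c ** wleft W s u"
    define K where "K u = smat (1 / ?k) (\<Sum>s\<leftarrow>[0..<length W]. smat (?\<sigma> s) (?M s u))" for u
    have "mbound (real (length W) / real CARD('k)) (K u)" if u: "u \<in> space PP" for u
    proof -
      have "mbound 1 (smat (?\<sigma> s) (?M s u))" if "s < length W" for s
      proof (rule mbound_mono[OF mbound_smat])
        show "mbound 1 (?M s u)"
          using mfun_wleft[OF W that] mfun_wright[OF W that] c u
          by (auto simp: mfun_def intro!: mbound_mult1)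
      qed (simp add: cmod_lsgn_le)
      then have "mbound (real (length [0..<length W])) (\<Sum>s\<leftarrow>[0..<length W]. smat (?\<sigma> s) (?M s u))"
        by (intro mbound_sum_list) auto
      from mbound_smat[OF this, of "1 / ?k"] show ?thesis
        by (simp add: K_def norm_divide)
    qed
    moreover have "taylor j (\<lambda>u. ntrace (weval W u ** c)) (\<lambda>i p u. K u $ p $ i)"
    proof -
      have "mder j (\<lambda>u. weval W u ** c) (map (\<lambda>(\<sigma>, L, R). (\<sigma>, L, \<lambda>u. R u ** c)) (splits j W))"
        using mder_mult[OF j mder_weval[OF j W] mder_const[of j c]] by simp
      then have "taylor j (\<lambda>u. (weval W u ** c) $ a $ a)
        (\<lambda>i p u. \<Sum>s\<leftarrow>[0..<length W]. ?\<sigma> s * wleft W s u $ a $ i * (wright W s u ** c) $ p $ a)" for a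
        unfolding mder_def splits_def by (simp add: o_def)
      from taylor_mult[OF j taylor_const[of j "1 / ?k"] taylor_sum[OF finite this]]
      have "taylor j (\<lambda>u. 1 / ?k * (\<Sum>a\<in>UNIV. (weval W u ** c) $ a $ a))
        (\<lambda>i p u. 1 / ?k * (\<Sum>a\<in>UNIV. \<Sum>s\<leftarrow>[0..<length W]. ?\<sigma> s * wleft W s u $ a $ i * (wright W s u ** c) $ p $ a))"
        by simp
      moreover have "(\<Sum>a\<in>UNIV. \<Sum>s\<leftarrow>xs. ?\<sigma> s * wleft W s u $ a $ i * (wright W s u ** c) $ p $ a) =
          (\<Sum>s\<leftarrow>xs. smat (?\<sigma> s) (?M s u)) $ p $ i" for i p u and xs :: "nat list"
      proof (induction xs)
        case (Cons s xs)
        have "(\<Sum>a\<in>UNIV. ?\<sigma> s * wleft W s u $ a $ i * (wright W s u ** c) $ p $ a) =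
            ?\<sigma> s * ?M s u $ p $ i"
          unfolding matrix_matrix_mult_def[of "wright W s u ** c"]
          by (simp add: sum_distrib_left mult_ac)
        then show ?case using Cons by (simp add: sum.distrib)
      qed simp
      ultimately show ?thesis
        by (simp add: K_def ntrace_def trace_def)
    qed
    ultimately show ?thesis by blast
  qed
  moreover have "mfun (\<lambda>u. weval W u ** c)"
    by (intro mfun_mult mfun_weval W mfun_const c)
  ultimately show ?thesis
    by (intro obsI mfun_ntrace_measurable mfun_ntrace_le)
qed

end

section \<open>Induction on the length of a word\<close>

text \<open>Reducedness for words with constants: two adjacent letters may be inverse to each other
  only across a traceless constant.\<close>

definition good2 :: "(nat \<times> bool) \<times> 'k::finite cmat \<Rightarrow> (nat \<times> bool) \<times> 'k cmat \<Rightarrow> bool" where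
  "good2 x y \<longleftrightarrow> (fst (fst x) = fst (fst y) \<and> snd (fst x) \<noteq> snd (fst y) \<longrightarrow> trace (snd x) = 0)"

lemma successively_take: "successively P W \<Longrightarrow> successively P (take s W)"
  using successively_append_iff[of P "take s W" "drop s W"] by simp

lemma sum_power2_real: "(\<Sum>s<q. (2::real) ^ s) = 2 ^ q - 1"
  by (induction q) auto

lemma ntrace_mult_commute: "ntrace (A ** B) = ntrace (B ** (A :: 'k::finite cmat))"
  by (simp only: ntrace_def trace_mul_sym[of A B])

lemma trace_eq_ntrace: "trace (A :: 'k::finite cmat) = of_nat CARD('k) * ntrace A"
  by (simp add: ntrace_def)

context haar_power
begin

lemma integrable_ntrace_mult:
  assumes "mfun Z" "obs N H"
  shows "integrable PP (\<lambda>u. ntrace (Z u) * H u)"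
proof (rule prod.integrable_const_bound[where B = 1])
  have "cmod (ntrace (Z u) * H u) \<le> 1" if "u \<in> space PP" for u
    unfolding norm_mult using mfun_ntrace_le[OF assms(1) that] obsD(2)[OF assms(2) that]
    by (intro mult_le_one) auto
  then show "AE u in PP. cmod (ntrace (Z u) * H u) \<le> 1" by (intro AE_I2)
  show "(\<lambda>u. ntrace (Z u) * H u) \<in> borel_measurable PP"
    by (rule borel_measurable_times[OF mfun_ntrace_measurable[OF assms(1)] obsD(1)[OF assms(2)]])
qed

text \<open>The loop equation as an estimate. One cut in \<open>S\<close> has a trivial side of
  trace k and returns \<open>Z\<close> itself; this is the term with \<open>\<zeta>\<close>, for
  which the equation is solved. The remaining cuts are bounded by \<open>B\<close>, and the gradient
  term by N/k, divided by k.\<close>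

lemma loop_bound:
  fixes L' R' :: "nat \<Rightarrow> (nat \<Rightarrow> 'k cmat) \<Rightarrow> 'k cmat"
  assumes j: "j < n" and Z: "mfun Z" "mder j Z S" and H: "obs N H"
    and S: "\<And>u. u \<in> space PP \<Longrightarrow> (\<Sum>(\<sigma>, L, R)\<leftarrow>S. \<sigma> * trace (L u) * trace (R u)) =
        \<zeta> * of_nat CARD('k) * trace (Z u) + (\<Sum>s<q. \<sigma>' s * trace (L' s u) * trace (R' s u))"
    and \<zeta>: "cmod \<zeta> = 1"
    and int: "\<And>s. s < q \<Longrightarrow> integrable PP (\<lambda>u. \<sigma>' s * (ntrace (L' s u) * (ntrace (R' s u) * H u)))"
    and bnd: "\<And>s. s < q \<Longrightarrow> cmod (\<integral>u. \<sigma>' s * (ntrace (L' s u) * (ntrace (R' s u) * H u)) \<partial>PP) \<le> B s"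
  shows "cmod (\<integral>u. ntrace (Z u) * H u \<partial>PP) \<le> (\<Sum>s<q. B s) + real N / (real CARD('k))\<^sup>2"
proof -
  let ?k = "of_nat CARD('k) :: complex"
  obtain G where G: "\<And>u. u \<in> space PP \<Longrightarrow> mbound (real N / real CARD('k)) (G u)"
    "taylor j H (\<lambda>i p u. G u $ p $ i)"
    using H j unfolding obs_def by metis
  have G_meas: "(\<lambda>u. G u $ p $ i) \<in> borel_measurable PP" for p i
    using G(2) unfolding taylor_def by blast
  have ZG_le: "cmod (ntrace (Z u ** G u)) \<le> real N / real CARD('k)" if "u \<in> space PP" for u
    using mbound_mult[of 1 "Z u" _ "G u"] Z(1) G(1)[OF that] that
    by (intro cmod_ntrace_le) (auto simp: mfun_def)
  have ZG_int: "integrable PP (\<lambda>u. ntrace (Z u ** G u) / ?k)"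
  proof (intro integrable_divide prod.integrable_const_bound[where B = "real N / real CARD('k)"])
    show "(\<lambda>u. ntrace (Z u ** G u)) \<in> borel_measurable PP"
      using Z(1) G_meas unfolding ntrace_def trace_def matrix_matrix_mult_def mfun_def
      by (auto intro!: borel_measurable_sum borel_measurable_divide borel_measurable_times)
  qed (use ZG_le in auto)
  define T where "T s u = \<sigma>' s * (ntrace (L' s u) * (ntrace (R' s u) * H u))" for s u
  have T_int: "integrable PP (T s)" if "s < q" for s
    using int[OF that] by (simp only: T_def[abs_def])
  have "0 = (\<integral>u. (\<Sum>(\<sigma>, L, R)\<leftarrow>S. \<sigma> * trace (L u) * trace (R u)) * H u + trace (Z u ** G u) \<partial>PP)"
    using loop_equation[OF j Z(2) G(2)] by simp
  \<comment> \<open>Normalizing the two traces of a cut takes out k^2, as does k times the trace of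
    \<open>Z\<close>; the single trace with \<open>G\<close> leaves a factor 1/k behind.\<close>
  also have "\<dots> = (\<integral>u. ?k\<^sup>2 * (\<zeta> * (ntrace (Z u) * H u) + (\<Sum>s<q. T s u) + ntrace (Z u ** G u) / ?k) \<partial>PP)"
  proof (rule Bochner_Integration.integral_cong)
    fix u assume u: "u \<in> space PP"
    have "(\<Sum>s<q. \<sigma>' s * trace (L' s u) * trace (R' s u)) * H u = ?k\<^sup>2 * (\<Sum>s<q. T s u)"
      unfolding sum_distrib_left sum_distrib_right T_def trace_eq_ntrace
      by (intro sum.cong) (auto simp: power2_eq_square)
    then show "(\<Sum>(\<sigma>, L, R)\<leftarrow>S. \<sigma> * trace (L u) * trace (R u)) * H u + trace (Z u ** G u) =
        ?k\<^sup>2 * (\<zeta> * (ntrace (Z u) * H u) + (\<Sum>s<q. T s u) + ntrace (Z u ** G u) / ?k)"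
      unfolding S[OF u] by (simp add: trace_eq_ntrace power2_eq_square algebra_simps)
  qed simp
  also have "\<dots> = ?k\<^sup>2 * (\<zeta> * (\<integral>u. ntrace (Z u) * H u \<partial>PP) + (\<Sum>s<q. \<integral>u. T s u \<partial>PP) +
      (\<integral>u. ntrace (Z u ** G u) / ?k \<partial>PP))"
  proof -
    have expand: "(\<integral>u. ?k\<^sup>2 * (\<zeta> * A u + (\<Sum>s<q. T s u) + C u) \<partial>PP) =
        ?k\<^sup>2 * (\<zeta> * (\<integral>u. A u \<partial>PP) + (\<Sum>s<q. \<integral>u. T s u \<partial>PP) + (\<integral>u. C u \<partial>PP))"
      if "integrable PP A" "integrable PP C" for A C
    proof -
      have sum: "integrable PP (\<lambda>u. \<Sum>s<q. T s u)"
        "(\<integral>u. (\<Sum>s<q. T s u) \<partial>PP) = (\<Sum>s<q. \<integral>u. T s u \<partial>PP)"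
        using T_int by (auto intro!: Bochner_Integration.integrable_sum Bochner_Integration.integral_sum)
      then show ?thesis
        using that by (simp add: Bochner_Integration.integral_add Bochner_Integration.integrable_add)
    qed
    show ?thesis
      by (rule expand[OF integrable_ntrace_mult[OF Z(1) H] ZG_int])
  qed
  finally have "\<zeta> * (\<integral>u. ntrace (Z u) * H u \<partial>PP) + (\<Sum>s<q. \<integral>u. T s u \<partial>PP) +
      (\<integral>u. ntrace (Z u ** G u) / ?k \<partial>PP) = 0"
    by simp
  then have eq: "\<zeta> * (\<integral>u. ntrace (Z u) * H u \<partial>PP) =
      - (\<Sum>s<q. \<integral>u. T s u \<partial>PP) - (\<integral>u. ntrace (Z u ** G u) / ?k \<partial>PP)"
    by (simp only: eq_neg_iff_add_eq_0 diff_conv_add_uminus minus_add_distrib[symmetric] add.assoc)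
  have "cmod (\<integral>u. ntrace (Z u) * H u \<partial>PP) = cmod (\<zeta> * (\<integral>u. ntrace (Z u) * H u \<partial>PP))"
    by (simp add: norm_mult \<zeta>)
  also have "\<dots> \<le> cmod (\<Sum>s<q. \<integral>u. T s u \<partial>PP) + cmod (\<integral>u. ntrace (Z u ** G u) / ?k \<partial>PP)"
    unfolding eq using norm_triangle_ineq4[of "- (\<Sum>s<q. \<integral>u. T s u \<partial>PP)"] by simp
  also have "cmod (\<Sum>s<q. \<integral>u. T s u \<partial>PP) \<le> (\<Sum>s<q. B s)"
    using bnd by (intro sum_norm_le) (auto simp: T_def)
  also have "cmod (\<integral>u. ntrace (Z u ** G u) / ?k \<partial>PP) \<le> (\<integral>u. real N / (real CARD('k))\<^sup>2 \<partial>PP)"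
    using ZG_le by (intro norm_integral_le ZG_int)
      (auto simp: norm_divide power2_eq_square field_simps)
  also have "\<dots> = real N / (real CARD('k))\<^sup>2"
    by (simp add: measure_space_PP)
  finally show ?thesis by simp
qed

lemma lett_inverse:
  assumes "u \<in> space PP" "fst l < n" "fst l = fst l'" "snd l \<noteq> snd l'"
  shows "lett l u ** lett l' u = mat 1"
  using space_PP_unitary[OF assms(1,2)] assms(3,4) by (auto simp: lett_def unitary_mats_def)

text \<open>\<open>H\<close> and \<open>N\<close> are arbitrary in the induction because each cut
  absorbs its second piece into \<open>H\<close>; the constant \<open>c\<close> in front is what
  remains when an inverse pair cancels cyclically.\<close>

lemma word_bound:
  assumes "W \<noteq> []" "wordn n W" "successively good2 W" "mbound 1 c" "obs N H"
  shows "cmod (\<integral>u. ntrace (c ** weval W u) * H u \<partial>PP)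
    \<le> 2 ^ (length W - 1) * real (N + length W) / (real CARD('k))\<^sup>2"
  using assms
proof (induction "length W" arbitrary: W c N H rule: less_induct)
  case less
  obtain x W' where W: "W = x # W'" using less.prems(1) by (cases W) auto
  let ?j = "fst (fst x)"
  let ?q = "length W'"
  let ?b = "real (N + length W) / (real CARD('k))\<^sup>2"
  note H = less.prems(5) and c = less.prems(4)
  have j: "?j < n" and a0: "mbound 1 (snd x)" and W': "wordn n W'" and sW': "successively good2 W'"
    using less.prems W by (auto simp: wordn_def successively_Cons)
  have good0: "trace (snd x) = 0"
    if "0 < ?q" "fst (fst (W' ! 0)) = ?j" "snd (fst (W' ! 0)) \<noteq> snd (fst x)"
    using less.prems(3) that by (auto simp: W successively_Cons good2_def hd_conv_nth)
  have y: "fst (fst (W' ! s)) < n" "mbound 1 (snd (W' ! s))" if "s < ?q" for s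
    using W' that by (auto simp: wordn_def)
  \<comment> \<open>A generic cut at later letter \<open>s\<close>: the first piece goes to the
    induction hypothesis, the second joins \<open>H\<close> and adds \<open>length Vb\<close> to
    \<open>N\<close>. The first piece has at most s + 1 letters, so it is shorter than
    \<open>W\<close> and costs at most 2^s. If it has no letters, only the trace of
    \<open>ca\<close> is left, which is zero.\<close>
  have split: "cmod (\<integral>u. \<sigma> * (ntrace (L u) * (ntrace (R u) * H u)) \<partial>PP) \<le> 2 ^ s * ?b"
    if s: "s < ?q" and Va: "wordn n Va" "successively good2 Va" "mbound 1 ca" "length Va \<le> Suc s"
      and L: "\<And>u. u \<in> space PP \<Longrightarrow> ntrace (L u) = ntrace (ca ** weval Va u)"
      and V: "wordn n Vb" "mbound 1 cb" "length Va + length Vb \<le> length W"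
      and R: "\<And>u. u \<in> space PP \<Longrightarrow> ntrace (R u) = ntrace (weval Vb u ** cb)"
      and nil: "Va = [] \<Longrightarrow> trace ca = 0" and \<sigma>: "cmod \<sigma> \<le> 1"
    for s \<sigma> Va Vb ca cb and L R :: "(nat \<Rightarrow> 'k cmat) \<Rightarrow> 'k cmat"
  proof -
    have "cmod (\<integral>u. \<sigma> * (ntrace (L u) * (ntrace (R u) * H u)) \<partial>PP) =
        cmod (\<integral>u. \<sigma> * (ntrace (ca ** weval Va u) * (ntrace (weval Vb u ** cb) * H u)) \<partial>PP)"
      by (intro arg_cong[where f = cmod] Bochner_Integration.integral_cong) (auto simp: L R)
    also have "\<dots> = cmod \<sigma> * cmod (\<integral>u. ntrace (ca ** weval Va u) * (ntrace (weval Vb u ** cb) * H u) \<partial>PP)"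
      by (simp add: norm_mult)
    also have "\<dots> \<le> 1 * cmod (\<integral>u. ntrace (ca ** weval Va u) * (ntrace (weval Vb u ** cb) * H u) \<partial>PP)"
      by (intro mult_right_mono \<sigma>) auto
    also have "\<dots> \<le> 2 ^ s * ?b"
    proof (cases "Va = []")
      case True
      then show ?thesis by (simp add: nil ntrace_def)
    next
      case False
      have "cmod (\<integral>u. ntrace (ca ** weval Va u) * (ntrace (weval Vb u ** cb) * H u) \<partial>PP)
          \<le> 2 ^ (length Va - 1) * real (length Vb + N + length Va) / (real CARD('k))\<^sup>2"
        using s Va(4) by (intro less.hyps False Va obs_mult obs_word V H) (auto simp: W)
      also have "\<dots> \<le> 2 ^ s * real (N + length W) / (real CARD('k))\<^sup>2"
        using Va(4) V(3) by (intro divide_right_mono mult_mono power_increasing) auto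
      finally show ?thesis by simp
    qed
    finally show ?thesis .
  qed
  have integ: "integrable PP (\<lambda>u. \<sigma> * (ntrace (L u) * (ntrace (R u) * H u)))"
    if "mfun L" "mfun R" for \<sigma> L R
  proof (rule integrable_mult_right, rule prod.integrable_const_bound[where B = 1])
    have "cmod (ntrace (L u) * (ntrace (R u) * H u)) \<le> 1" if u: "u \<in> space PP" for u
      unfolding norm_mult
      using mfun_ntrace_le[OF \<open>mfun L\<close> u] mfun_ntrace_le[OF \<open>mfun R\<close> u] obsD(2)[OF H u]
      by (intro mult_le_one mult_nonneg_nonneg) auto
    then show "AE u in PP. cmod (ntrace (L u) * (ntrace (R u) * H u)) \<le> 1" by (intro AE_I2)
  qed (intro borel_measurable_times mfun_ntrace_measurable that obsD(1)[OF H])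
  have "cmod (\<integral>u. ntrace (c ** weval W u) * H u \<partial>PP)
      \<le> (\<Sum>s<?q. 2 ^ s * ?b) + real N / (real CARD('k))\<^sup>2"
  proof (cases "snd (fst x)")
    case F: False
    \<comment> \<open>A generator is cut on its left, so the cut at the first letter has pieces
      \<open>mat 1\<close> and \<open>Z\<close>, with sign 1.\<close>
    define Z where "Z u = weval W u ** c" for u
    define L where "L s = wleft W (Suc s)" for s
    define R where "R s u = wright W (Suc s) u ** c" for s u
    have Zder: "mder ?j Z (map (\<lambda>(\<sigma>, L, R). (\<sigma>, L, \<lambda>u. R u ** c)) (splits ?j W))"
      using mder_mult[OF j mder_weval[OF j less.prems(2)] mder_const[of ?j c]] by (simp add: Z_def[abs_def])
    have "cmod (\<integral>u. ntrace (Z u) * H u \<partial>PP) \<le> (\<Sum>s<?q. 2 ^ s * ?b) + real N / (real CARD('k))\<^sup>2"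
    proof (rule loop_bound[OF j _ Zder H, where \<zeta> = 1 and \<sigma>' = "\<lambda>s. lsgn ?j (fst (W' ! s))" and L' = L and R' = R])
      show "mfun Z"
        unfolding Z_def[abs_def] by (intro mfun_mult mfun_weval mfun_const c less.prems(2))
      have "mat 1 ** lpre (fst x) u = mat 1" for u :: "nat \<Rightarrow> 'k cmat"
        using F by (simp add: lpre_def)
      moreover have "lsuf (fst x) u ** snd x ** weval W' u = weval W u" for u
        using F by (simp add: lsuf_def W)
      moreover have "lsgn ?j (fst x) = 1"
        using F by (simp add: lsgn_def)
      ultimately show "(\<Sum>(\<sigma>, L, R)\<leftarrow>map (\<lambda>(\<sigma>, L, R). (\<sigma>, L, \<lambda>u. R u ** c)) (splits ?j W).
           \<sigma> * trace (L u) * trace (R u)) = 1 * of_nat CARD('k) * trace (Z u) +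
           (\<Sum>s<?q. lsgn ?j (fst (W' ! s)) * trace (L s u) * trace (R s u))" for u
        using F unfolding splits_def
        by (simp add: o_def interv_sum_list_conv_sum_set_nat atLeast0LessThan W sum.lessThan_Suc_shift L_def R_def Z_def
            wleft_def[of _ 0] wright_def[of _ 0] trace_I del: sum.lessThan_Suc upt_Suc weval.simps(2))
    next
      fix s assume s: "s < ?q"
      then have s': "Suc s < length W" by (simp add: W)
      show "integrable PP (\<lambda>u. lsgn ?j (fst (W' ! s)) * (ntrace (L s u) * (ntrace (R s u) * H u)))"
        unfolding L_def R_def
        by (intro integ mfun_mult mfun_wleft mfun_wright mfun_const less.prems(2) s' c)
      show "cmod (\<integral>u. lsgn ?j (fst (W' ! s)) * (ntrace (L s u) * (ntrace (R s u) * H u)) \<partial>PP) \<le> 2 ^ s * ?b"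
      proof (cases "fst (fst (W' ! s)) = ?j")
        case False
        then show ?thesis by (simp add: lsgn_def)
      next
        case eqj: True
        show ?thesis
        proof (cases "snd (fst (W' ! s))")
          case False
          \<comment> \<open>Two equal generators: cutting before the second one leaves a prefix of
            \<open>W\<close>, which is again good, and the rest.\<close>
          have "drop (Suc s) W = W' ! s # drop (Suc (Suc s)) W"
            using Cons_nth_drop_Suc[OF s'] by (simp add: W)
          then have "wright W (Suc s) u = weval (drop (Suc s) W) u" "wleft W (Suc s) u = weval (take (Suc s) W) u"
            for u :: "nat \<Rightarrow> 'k cmat"
            using False by (simp_all add: wright_def wleft_def lsuf_def lpre_def W)
          then show ?thesis
            using s c wordn_take[OF less.prems(2), of "Suc s"] wordn_drop[OF less.prems(2), of "Suc s"]
              successively_take[OF less.prems(3), of "Suc s"]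
            by (intro split[where ?Va1 = "take (Suc s) W" and ?ca1 = "mat 1" and ?Vb1 = "drop (Suc s) W" and ?cb1 = c])
              (auto simp: L_def R_def W cmod_lsgn_le)
        next
          case True
          \<comment> \<open>A generator and its inverse: the first piece starts with one and ends
            with the other. They cancel cyclically and leave \<open>snd x\<close> in front of the
            \<open>s\<close> letters between them; for s = 0 only \<open>snd x\<close> is left,
            which \<open>good0\<close> makes traceless.\<close>
          have "ntrace (L s u) = ntrace (snd x ** weval (take s W') u)" if "u \<in> space PP" for u
          proof -
            have "L s u = (lett (fst x) u ** snd x ** weval (take s W') u) ** lett (fst (W' ! s)) u"
              using True by (simp add: L_def wleft_def lpre_def W matrix_mul_assoc)
            then have "ntrace (L s u) =
                ntrace (lett (fst (W' ! s)) u ** (lett (fst x) u ** snd x ** weval (take s W') u))"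
              by (simp only: ntrace_mult_commute)
            also have "\<dots> = ntrace ((lett (fst (W' ! s)) u ** lett (fst x) u) ** (snd x ** weval (take s W') u))"
              by (simp only: matrix_mul_assoc)
            finally show ?thesis
              using lett_inverse[OF that y(1)[OF s] eqj] True F by simp
          qed
          moreover have "ntrace (R s u) = ntrace (weval (drop (Suc s) W') u ** (c ** snd (W' ! s)))" for u
          proof -
            have "R s u = snd (W' ! s) ** (weval (drop (Suc s) W') u ** c)"
              using True by (simp add: R_def wright_def lsuf_def W matrix_mul_assoc)
            then have "ntrace (R s u) = ntrace (weval (drop (Suc s) W') u ** c ** snd (W' ! s))"
              by (simp only: ntrace_mult_commute[of "snd (W' ! s)"])
            then show ?thesis
              by (simp only: matrix_mul_assoc)
          qed
          moreover have "trace (snd x) = 0" if "take s W' = []"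
            using that s eqj True F by (intro good0) auto
          ultimately show ?thesis
            using s a0 c y[OF s] wordn_take[OF W', of s] wordn_drop[OF W', of "Suc s"] successively_take[OF sW', of s]
            by (intro split[where ?Va1 = "take s W'" and ?ca1 = "snd x" and ?Vb1 = "drop (Suc s) W'" and ?cb1 = "c ** snd (W' ! s)"])
              (auto simp: W cmod_lsgn_le intro: mbound_mult1)
        qed
      qed
    qed auto
    moreover have "ntrace (Z u) = ntrace (c ** weval W u)" for u
      unfolding Z_def by (rule ntrace_mult_commute)
    ultimately show ?thesis by simp
  next
    case T: True
    \<comment> \<open>An inverse letter is cut on its right. Moving the first letter cyclically to
      the end makes its cut have the pieces \<open>Z\<close> and \<open>mat 1\<close>, with sign
      -1.\<close>
    define Z where "Z u = snd x ** weval W' u ** c ** lett (fst x) u" for u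
    define L where "L s u = snd x ** wleft W' s u" for s u
    define R where "R s u = wright W' s u ** c ** lett (fst x) u" for s u
    let ?S = "map (\<lambda>s. (lsgn ?j (fst (W' ! s)), L s, R s)) [0..<?q] @
       [(lsgn ?j (fst x), \<lambda>u. snd x ** weval W' u ** c ** lpre (fst x) u, lsuf (fst x))]"
    have Zder: "mder ?j Z ?S"
      using mder_mult[OF j mder_mult[OF j mder_mult[OF j mder_const[of ?j "snd x"] mder_weval[OF j W']]
            mder_const[of ?j c]] mder_lett[OF j j]]
      by (simp add: Z_def[abs_def] L_def[abs_def] R_def[abs_def] splits_def o_def)
    have "cmod (\<integral>u. ntrace (Z u) * H u \<partial>PP) \<le> (\<Sum>s<?q. 2 ^ s * ?b) + real N / (real CARD('k))\<^sup>2"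
    proof (rule loop_bound[OF j _ Zder H, where \<zeta> = "-1" and \<sigma>' = "\<lambda>s. lsgn ?j (fst (W' ! s))" and L' = L and R' = R])
      show "mfun Z"
        unfolding Z_def[abs_def] by (intro mfun_mult mfun_weval mfun_const mfun_lett a0 c W' j)
      show "(\<Sum>(\<sigma>, L, R)\<leftarrow>?S. \<sigma> * trace (L u) * trace (R u)) = - 1 * of_nat CARD('k) * trace (Z u) +
           (\<Sum>s<?q. lsgn ?j (fst (W' ! s)) * trace (L s u) * trace (R s u))" for u
        using T by (simp add: o_def interv_sum_list_conv_sum_set_nat atLeast0LessThan Z_def lsgn_def lpre_def lsuf_def trace_I
            del: upt_Suc)
    next
      fix s assume s: "s < ?q"
      show "integrable PP (\<lambda>u. lsgn ?j (fst (W' ! s)) * (ntrace (L s u) * (ntrace (R s u) * H u)))"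
        unfolding L_def R_def
        by (intro integ mfun_mult mfun_wleft mfun_wright mfun_const mfun_lett W' s c a0 j)
      show "cmod (\<integral>u. lsgn ?j (fst (W' ! s)) * (ntrace (L s u) * (ntrace (R s u) * H u)) \<partial>PP) \<le> 2 ^ s * ?b"
      proof (cases "fst (fst (W' ! s)) = ?j")
        case False
        then show ?thesis by (simp add: lsgn_def)
      next
        case eqj: True
        show ?thesis
        proof (cases "snd (fst (W' ! s))")
          case False
          \<comment> \<open>Opposite letters: after a cyclic shift they meet at the start of the
            second piece. That piece enters only as an observable measured by its length, so the
            pair can stay there uncancelled.\<close>
          have "drop s W' = W' ! s # drop (Suc s) W'"
            using Cons_nth_drop_Suc[OF s] by simp
          then have "R s u = weval (drop s W') u ** c ** lett (fst x) u" for u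
            using False by (simp add: R_def wright_def lsuf_def)
          then have "ntrace (R s u) = ntrace (weval ((fst x, mat 1) # drop s W') u ** c)" for u
            by (simp add: ntrace_mult_commute[of _ "lett (fst x) u"] matrix_mul_assoc)
          moreover have "L s u = snd x ** weval (take s W') u" for u
            using False by (simp add: L_def wleft_def lpre_def)
          moreover have "trace (snd x) = 0" if "take s W' = []"
            using that s eqj False T by (intro good0) auto
          moreover have "wordn n ((fst x, mat 1) # drop s W')"
            using wordn_drop[OF W', of s] j by (simp add: wordn_def)
          ultimately show ?thesis
            using s a0 c wordn_take[OF W', of s] successively_take[OF sW', of s]
            by (intro split[where ?Va1 = "take s W'" and ?ca1 = "snd x" and ?Vb1 = "(fst x, mat 1) # drop s W'" and ?cb1 = c])
              (auto simp: W cmod_lsgn_le)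
        next
          case True
          \<comment> \<open>Two equal inverse letters: the cut falls after the second one, whose
            constant passes to the other piece, so \<open>?U\<close> ends with \<open>mat 1\<close>.
            \<open>good2\<close> tests only constants followed by a letter, so \<open>?U\<close>
            inherits it from \<open>W'\<close>.\<close>
          let ?U = "take s W' @ [(fst (W' ! s), mat 1)]"
          have "R s u = snd (W' ! s) ** weval (drop (Suc s) W') u ** c ** lett (fst x) u" for u
            using True by (simp add: R_def wright_def lsuf_def)
          then have "ntrace (R s u) = ntrace (weval ((fst x, snd (W' ! s)) # drop (Suc s) W') u ** c)" for u
            by (simp add: ntrace_mult_commute[of _ "lett (fst x) u"] matrix_mul_assoc)
          moreover have "L s u = snd x ** weval ?U u" for u
            using True by (simp add: L_def wleft_def lpre_def weval_append)
          moreover have "wordn n ((fst x, snd (W' ! s)) # drop (Suc s) W')"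
            using wordn_drop[OF W', of "Suc s"] j y(2)[OF s] by (simp add: wordn_def)
          moreover have "wordn n ?U"
            using wordn_take[OF W', of s] y(1)[OF s] by (auto simp: wordn_def)
          moreover have "successively good2 ?U"
            using successively_take[OF sW', of "Suc s"] s
            by (auto simp: take_Suc_conv_app_nth successively_append_iff good2_def)
          ultimately show ?thesis
            using s a0 c
            by (intro split[where ?Va1 = ?U and ?ca1 = "snd x" and ?Vb1 = "(fst x, snd (W' ! s)) # drop (Suc s) W'" and ?cb1 = c])
              (auto simp: W cmod_lsgn_le)
        qed
      qed
    qed auto
    moreover have "ntrace (Z u) = ntrace (c ** weval W u)" for u
      unfolding Z_def W weval.simps ntrace_mult_commute[of _ "lett (fst x) u"] ntrace_mult_commute[of c]
      by (simp only: matrix_mul_assoc)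
    ultimately show ?thesis by simp
  qed
  \<comment> \<open>The geometric sum leaves one copy of \<open>?b\<close> to spare, which pays for
    the gradient term.\<close>
  also have "\<dots> = (2 ^ ?q - 1) * ?b + real N / (real CARD('k))\<^sup>2"
    by (simp only: sum_power2_real flip: sum_distrib_right)
  also have "real N / (real CARD('k))\<^sup>2 \<le> ?b"
    by (intro divide_right_mono) auto
  also have "(2 ^ ?q - 1) * ?b + ?b = 2 ^ ?q * ?b"
    by (simp only: left_diff_distrib mult_1_left diff_add_cancel)
  finally show ?case by (simp add: W)
qed

end

section \<open>Words in the free group\<close>

text \<open>Every letter needs one contraction behind it; this choice places the traceless matrices
  exactly at the block boundaries.\<close>

definition block :: "fword \<Rightarrow> 'k::finite cmat \<Rightarrow> ((nat \<times> bool) \<times> 'k cmat) list" where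
  "block g x = map (\<lambda>l. (l, mat 1)) (butlast g) @ [(last g, x)]"

definition flat :: "fword list \<Rightarrow> 'k::finite cmat list \<Rightarrow> ((nat \<times> bool) \<times> 'k cmat) list" where
  "flat gs xs = concat (map2 block gs xs)"

lemma flat_Cons: "flat (g # gs) (x # xs) = block g x @ flat gs xs"
  by (simp add: flat_def)

lemma length_block: "g \<noteq> [] \<Longrightarrow> length (block g x) = length g"
  by (simp add: block_def)

lemma length_flat:
  assumes "length gs = length xs" "\<forall>g\<in>set gs. g \<noteq> []"
  shows "length (flat gs xs) = (\<Sum>g\<leftarrow>gs. length g)"
  using assms by (induction gs xs rule: list_induct2) (auto simp: flat_def length_block)

lemma reduced_word_successively:
  "reduced_word g \<longleftrightarrow> successively (\<lambda>a b. \<not> (fst a = fst b \<and> snd a \<noteq> snd b)) g"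
  by (induction g rule: reduced_word.induct) auto

lemma good2_block:
  assumes "reduced_word g" "g \<noteq> []"
  shows "successively good2 (block g (x :: 'k::finite cmat))"
proof -
  have "successively (\<lambda>a b. \<not> (fst a = fst b \<and> snd a \<noteq> snd b)) (butlast g @ [last g])"
    using assms by (simp add: reduced_word_successively)
  then show ?thesis
    unfolding block_def successively_append_iff successively_map
    by (cases "butlast g = []") (auto simp: good2_def last_map elim: successively_mono)
qed

text \<open>Inside a block, reducedness excludes inverse neighbours; between blocks the separating
  constant has trace zero, whatever the adjacent letters are.\<close>

lemma good2_flat:
  assumes "length gs = length xs" "\<forall>g\<in>set gs. reduced_word g \<and> g \<noteq> []" "\<forall>x\<in>set xs. trace x = 0"
  shows "successively good2 (flat gs xs)"
  using assms
proof (induction gs xs rule: list_induct2)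
  case Nil
  then show ?case by (simp add: flat_def)
next
  case (Cons g gs x xs)
  then show ?case
    by (simp add: flat_Cons successively_append_iff good2_block) (simp add: block_def good2_def)
qed

lemma wordn_block:
  assumes "word_over n g" "g \<noteq> []" "mbound 1 x"
  shows "wordn n (block g x)"
  using assms by (auto simp: wordn_def block_def word_over_def dest: in_set_butlastD)

lemma wordn_flat:
  assumes "length gs = length xs" "\<forall>g\<in>set gs. word_over n g \<and> g \<noteq> []" "\<forall>x\<in>set xs. mbound 1 x"
  shows "wordn n (flat gs xs)"
  using assms
proof (induction gs xs rule: list_induct2)
  case (Cons g gs x xs)
  then have "wordn n (block g x)" "wordn n (flat gs xs)"
    by (auto intro: wordn_block)
  then show ?case by (auto simp: flat_Cons wordn_def)
qed (simp add: flat_def wordn_def)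

lemma eval_word_Cons:
  "eval_word (l # g) u = (if snd l then matrix_inv (u (fst l)) else u (fst l)) ** eval_word g u"
  by (simp add: eval_word_def case_prod_beta)

lemma weval_eq_eval_word:
  assumes "\<forall>l\<in>set g. u (fst l) \<in> unitary_mats"
  shows "weval (map (\<lambda>l. (l, mat 1)) g) u = eval_word g u"
  using assms
proof (induction g)
  case Nil
  then show ?case by (simp add: eval_word_def)
next
  case (Cons l g)
  then show ?case
    by (simp add: eval_word_Cons lett_def matrix_inv_unitary)
qed

lemma weval_block:
  assumes "\<forall>l\<in>set g. u (fst l) \<in> unitary_mats" "g \<noteq> []"
  shows "weval (block g x) u = eval_word g u ** x"
proof -
  have "eval_word g u = weval (map (\<lambda>l. (l, mat 1)) (butlast g @ [last g])) u"
    using weval_eq_eval_word[OF assms(1)] assms(2) by simp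
  then show ?thesis
    unfolding block_def by (simp add: weval_append matrix_mul_assoc)
qed

lemma smat_smat: "smat a (smat b A) = smat (a * b) A"
  by (simp add: vec_eq_iff)

lemma smat_1 [simp]: "smat 1 A = A"
  by (simp add: vec_eq_iff)

text \<open>Dividing each constant by \<open>c\<close> allows it to be made a contraction; the
  scalars are collected in front. On unitaries the inverses in \<open>eval_word\<close> are the
  adjoints in \<open>weval\<close>.\<close>

lemma word_product_eq:
  assumes "length gs = length xs" "\<forall>g\<in>set gs. g \<noteq> [] \<and> (\<forall>l\<in>set g. u (fst l) \<in> unitary_mats)" "c \<noteq> 0"
  shows "word_product gs xs u = smat (c ^ length gs) (weval (flat gs (map (smat (1 / c)) xs)) u)"
  using assms(1,2)
proof (induction gs xs rule: list_induct2)
  case Nil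
  then show ?case by (simp add: word_product_def flat_def)
next
  case (Cons g gs x xs)
  have "word_product (g # gs) (x # xs) u = eval_word g u ** x ** word_product gs xs u"
    by (simp add: word_product_def)
  also have "\<dots> = smat (c ^ length gs) (eval_word g u ** x ** weval (flat gs (map (smat (1 / c)) xs)) u)"
    using Cons by (simp add: smat_mult_right)
  also have "eval_word g u ** x = smat c (weval (block g (smat (1 / c) x)) u)"
    using Cons.prems assms(3) by (simp add: weval_block smat_mult_right smat_smat)
  finally show ?case
    by (simp add: flat_Cons weval_append smat_mult_left smat_smat mult.commute)
qed

section \<open>Numerical bounds\<close>

lemma bell_ge_1: "1 \<le> bell m"
proof -
  have "{R. equiv {..<m} R} \<subseteq> Pow ({..<m} \<times> {..<m})"
    by (auto dest: equiv_type)
  then have "finite {R. equiv {..<m} R}"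
    by (rule finite_subset) simp
  moreover have "Id_on {..<m} \<in> {R. equiv {..<m} R}"
    by (auto intro!: equivI refl_onI symI transI)
  ultimately have "card {R. equiv {..<m} R} > 0"
    using card_gt_0_iff by blast
  then show ?thesis by (simp add: bell_def)
qed

text \<open>From m < 2^m the left side is at most 2^(2m), and (m - 1)^2 \<ge> 0 gives 2m \<le> m^2 +
  1.\<close>

lemma mult_power2_le:
  assumes "0 < m"
  shows "real m * 2 ^ m \<le> 2 * 2 ^ m\<^sup>2"
proof -
  have "real m * 2 ^ m \<le> 2 ^ m * 2 ^ m"
    using of_nat_less_two_power[of m, where ?'a = real] by (intro mult_right_mono) auto
  also have "\<dots> = 2 ^ (2 * m)"
    by (simp add: mult_2 power_add)
  also have "\<dots> \<le> 2 ^ Suc (m\<^sup>2)"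
  proof (intro power_increasing)
    have "2 * int m \<le> int m ^ 2 + 1"
      using zero_le_power2[of "int m - 1"] by (simp add: power2_diff)
    then show "2 * m \<le> Suc (m\<^sup>2)"
      by (simp flip: of_nat_power)
  qed simp
  finally show ?thesis by simp
qed

theorem theorem1:
  fixes M :: real and m n w :: nat
    and gs :: "fword list" and xs :: "'k::finite cmat list"
    and \<mu> :: "'k cmat measure"
  assumes haar: "is_haar_unitary \<mu>"
    and M_pos: "M > 0" and m_pos: "m > 0" and n_pos: "n > 0"
    and len_gs: "length gs = w" and len_xs: "length xs = w"
    and words: "\<forall>g\<in>set gs. word_over n g \<and> reduced_word g \<and> g \<noteq> []"
    and m_def: "(\<Sum>g\<leftarrow>gs. length g) = m"
    and comm: "\<forall>x\<in>set xs. \<forall>y\<in>set xs. x ** y = y ** x"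
    and normal: "\<forall>x\<in>set xs. normal_mat x"
    and tr0: "\<forall>x\<in>set xs. trace x = 0"
    and bnd: "\<forall>x\<in>set xs. opnorm x \<le> M"
  shows
    "cmod (integral\<^sup>L (PiM {..<n} (\<lambda>_. \<mu>)) (\<lambda>u. ntrace (word_product gs xs u)))
       \<le> real (bell m) * 2 ^ (m\<^sup>2) * (M * real w) ^ w / real CARD('k)
  \<and>
    (\<integral>u. (cmod (ntrace (word_product gs xs u)))\<^sup>2 \<partial>(PiM {..<n} (\<lambda>_. \<mu>)))
       \<le> real (bell (2 * m)) * 4 ^ (m\<^sup>2) * (2 * M * real w) ^ (2 * w) / (real CARD('k))\<^sup>2
  \<and>
    (\<forall>\<epsilon>::real. \<epsilon> > 0 \<longrightarrow>
       real CARD('k) > 2 * real (bell m) * 2 ^ (m\<^sup>2) * (M * real w) ^ w / \<epsilon> \<longrightarrow>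
       measure (PiM {..<n} (\<lambda>_. \<mu>))
         {v \<in> space (PiM {..<n} (\<lambda>_. \<mu>)). cmod (ntrace (word_product gs xs v)) \<ge> \<epsilon>}
       \<le> 4 * real (bell (2 * m)) * 4 ^ (m\<^sup>2) * (2 * M * real w) ^ (2 * w)
           / ((real CARD('k))\<^sup>2 * \<epsilon>\<^sup>2))"
proof -
  interpret haar_power \<mu> n
    by unfold_locales (rule haar)
  \<comment> \<open>Since \<open>cmod c = M\<close>, dividing each matrix by \<open>c\<close> brings
    its operator norm down to at most 1.\<close>
  define c where "c = complex_of_real M"
  define W where "W = flat gs (map (smat (1 / c)) xs)"
  define f where "f u = ntrace (weval W u)" for u
  define F where "F u = ntrace (word_product gs xs u)" for u
  have c: "c \<noteq> 0" "cmod c = M"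
    using M_pos by (auto simp: c_def)
  have len: "length gs = length (map (smat (1 / c)) xs)"
    using len_gs len_xs by simp
  have "mbound 1 (smat (1 / c) x)" if "x \<in> set xs" for x
  proof (rule mbound_mono[OF mbound_smat[OF mbound_opnorm]])
    show "cmod (1 / c) * opnorm x \<le> 1"
      using bnd that c M_pos by (simp add: norm_divide)
  qed
  then have W: "wordn n W"
    unfolding W_def using words by (intro wordn_flat len) auto
  have lenW: "length W = m"
    unfolding W_def using length_flat[OF len] words m_def by simp
  then have W0: "W \<noteq> []"
    using m_pos by auto
  have goodW: "successively good2 W"
    unfolding W_def using words tr0 by (intro good2_flat len) (auto simp: trace_smat)
  have mW: "mfun (weval W)"
    by (rule mfun_weval[OF W])
  have F_eq: "F u = c ^ w * f u" if "u \<in> space PP" for u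
  proof -
    have "word_product gs xs u = smat (c ^ length gs) (weval W u)"
      unfolding W_def
      by (rule word_product_eq)
        (use words that c len_gs len_xs in \<open>auto simp: word_over_def intro!: space_PP_unitary\<close>)
    then show ?thesis
      by (simp add: F_def f_def ntrace_def trace_smat len_gs)
  qed
  have w1: "1 \<le> w"
    using m_def m_pos len_gs by (cases gs) auto
  have k1: "1 \<le> real CARD('k)"
    by (simp add: Suc_le_eq)
  have B1: "1 \<le> real (bell i)" for i
    using bell_ge_1[of i] by simp
  \<comment> \<open>First moment: \<open>H = 1\<close> and \<open>N = 0\<close> give the constant m
    2^(m-1), which is half the left side of \<open>mult_power2_le\<close>.\<close>
  have "cmod (\<integral>u. ntrace (mat 1 ** weval W u) * 1 \<partial>PP)
      \<le> 2 ^ (length W - 1) * real (0 + length W) / (real CARD('k))\<^sup>2"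
    by (rule word_bound[OF W0 W goodW _ obs_one]) simp
  moreover have "2 ^ (length W - 1) * real (0 + length W) \<le> 2 ^ m\<^sup>2"
    using mult_power2_le[OF m_pos] m_pos unfolding lenW by (cases m) (auto simp: mult.commute)
  ultimately have f1: "cmod (\<integral>u. f u \<partial>PP) \<le> 2 ^ m\<^sup>2 / (real CARD('k))\<^sup>2"
    unfolding f_def matrix_mul_lid mult_1_right by (meson divide_right_mono order_trans zero_le_power2)
  have obs: "obs m (\<lambda>u. cnj (f u))"
    using obs_cnj[OF obs_word[OF W mbound_one]] by (simp add: f_def[abs_def] lenW)
  \<comment> \<open>Second moment: \<open>H = cnj f\<close> and \<open>N = m\<close> turn the
    integrand into |f|^2 and the constant into 2^(m-1) * 2m.\<close>
  have "cmod (\<integral>u. ntrace (mat 1 ** weval W u) * cnj (f u) \<partial>PP)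
      \<le> 2 ^ (length W - 1) * real (m + length W) / (real CARD('k))\<^sup>2"
    by (rule word_bound[OF W0 W goodW _ obs]) simp
  moreover have "(\<integral>u. ntrace (mat 1 ** weval W u) * cnj (f u) \<partial>PP) =
      complex_of_real (\<integral>u. (cmod (f u))\<^sup>2 \<partial>PP)"
    unfolding integral_complex_of_real[symmetric] by (simp only: f_def matrix_mul_lid complex_norm_square)
  moreover have "2 ^ (length W - 1) * real (m + length W) = real m * 2 ^ m"
    using m_pos unfolding lenW by (cases m) auto
  ultimately have f2: "(\<integral>u. (cmod (f u))\<^sup>2 \<partial>PP) \<le> real m * 2 ^ m / (real CARD('k))\<^sup>2"
    by simp
  have "real m * 2 ^ m \<le> 4 ^ m\<^sup>2"
  proof -
    have "real m * 2 ^ m \<le> 2 * 2 ^ m\<^sup>2"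
      by (rule mult_power2_le[OF m_pos])
    also have "\<dots> \<le> 2 ^ m\<^sup>2 * 2 ^ m\<^sup>2"
      using power_increasing[of 1 "m\<^sup>2" "2::real"] m_pos by (intro mult_right_mono) auto
    also have "\<dots> = 4 ^ m\<^sup>2"
      by (simp flip: power_mult_distrib)
    finally show ?thesis .
  qed
  then have f2': "(\<integral>u. (cmod (f u))\<^sup>2 \<partial>PP) \<le> 4 ^ m\<^sup>2 / (real CARD('k))\<^sup>2"
    by (intro order_trans[OF f2] divide_right_mono) auto
  have "(\<integral>u. F u \<partial>PP) = c ^ w * (\<integral>u. f u \<partial>PP)"
    using Bochner_Integration.integral_cong[OF refl F_eq] by simp
  then have "cmod (\<integral>u. F u \<partial>PP) \<le> M ^ w * (2 ^ m\<^sup>2 / (real CARD('k))\<^sup>2)"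
    using f1 M_pos by (simp only: norm_mult norm_power c) (intro mult_left_mono, auto)
  also have "\<dots> = 1 * 2 ^ m\<^sup>2 * M ^ w / (real CARD('k))\<^sup>2"
    by simp
  \<comment> \<open>Weakening by k \<le> k^2, w \<ge> 1 and the lower bound 1 for Bell
    numbers.\<close>
  also have "\<dots> \<le> real (bell m) * 2 ^ m\<^sup>2 * (M * real w) ^ w / real CARD('k)"
    using M_pos w1 k1 by (intro frac_le mult_mono power_mono B1) (auto simp: power2_eq_square)
  finally have P1: "cmod (\<integral>u. F u \<partial>PP) \<le> real (bell m) * 2 ^ m\<^sup>2 * (M * real w) ^ w / real CARD('k)" .
  have "(\<integral>u. (cmod (F u))\<^sup>2 \<partial>PP) = (\<integral>u. M ^ (2 * w) * (cmod (f u))\<^sup>2 \<partial>PP)"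
    by (rule Bochner_Integration.integral_cong)
      (auto simp: F_eq norm_mult norm_power c power_mult_distrib mult.commute simp flip: power_mult)
  also have "\<dots> = M ^ (2 * w) * (\<integral>u. (cmod (f u))\<^sup>2 \<partial>PP)"
    by simp
  also have "\<dots> \<le> M ^ (2 * w) * (4 ^ m\<^sup>2 / (real CARD('k))\<^sup>2)"
    using M_pos by (intro mult_left_mono f2') auto
  also have "\<dots> = 1 * 4 ^ m\<^sup>2 * M ^ (2 * w) / (real CARD('k))\<^sup>2"
    by simp
  also have "\<dots> \<le> real (bell (2 * m)) * 4 ^ m\<^sup>2 * (2 * M * real w) ^ (2 * w) / (real CARD('k))\<^sup>2"
  proof (intro divide_right_mono mult_mono power_mono B1)
    have "M * 1 \<le> M * (2 * real w)"
      using M_pos w1 by (intro mult_left_mono) auto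
    then show "M \<le> 2 * M * real w" by (simp add: algebra_simps)
  qed (use M_pos in auto)
  finally have P2: "(\<integral>u. (cmod (F u))\<^sup>2 \<partial>PP)
      \<le> real (bell (2 * m)) * 4 ^ m\<^sup>2 * (2 * M * real w) ^ (2 * w) / (real CARD('k))\<^sup>2" (is "_ \<le> ?R") .
  have "integrable PP (\<lambda>u. (cmod (c ^ w * f u))\<^sup>2)"
  proof (rule prod.integrable_const_bound[where B = "(M ^ w)\<^sup>2"])
    have "(cmod (c ^ w * f u))\<^sup>2 \<le> (M ^ w)\<^sup>2" if "u \<in> space PP" for u
      using mfun_ntrace_le[OF mW that] M_pos
      by (intro power_mono) (auto simp: norm_mult norm_power c f_def mult_left_le)
    then show "AE u in PP. norm ((cmod (c ^ w * f u))\<^sup>2) \<le> (M ^ w)\<^sup>2"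
      by (intro AE_I2) simp
    have "f \<in> borel_measurable PP"
      using mfun_ntrace_measurable[OF mW] by (simp add: f_def[abs_def])
    then show "(\<lambda>u. (cmod (c ^ w * f u))\<^sup>2) \<in> borel_measurable PP"
      by simp
  qed
  then have int: "integrable PP (\<lambda>u. (cmod (F u))\<^sup>2)"
    by (rule Bochner_Integration.integrable_cong[THEN iffD2, rotated 2]) (simp_all add: F_eq)
  \<comment> \<open>Markov's inequality for |F|^2 at level \<epsilon>^2; the resulting bound is
    nonnegative, so it may be multiplied by 4.\<close>
  have P3: "measure PP {v \<in> space PP. \<epsilon> \<le> cmod (F v)}
      \<le> 4 * real (bell (2 * m)) * 4 ^ m\<^sup>2 * (2 * M * real w) ^ (2 * w) / ((real CARD('k))\<^sup>2 * \<epsilon>\<^sup>2)"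
    if \<epsilon>: "0 < \<epsilon>" for \<epsilon>
  proof -
    have R0: "0 \<le> ?R / \<epsilon>\<^sup>2"
      using M_pos by (intro divide_nonneg_nonneg mult_nonneg_nonneg) auto
    have "{v \<in> space PP. \<epsilon> \<le> cmod (F v)} = {v \<in> space PP. \<epsilon>\<^sup>2 \<le> (cmod (F v))\<^sup>2}"
      using \<epsilon> by (auto simp: abs_le_square_iff[symmetric])
    then have "measure PP {v \<in> space PP. \<epsilon> \<le> cmod (F v)} \<le> (\<integral>u. (cmod (F u))\<^sup>2 \<partial>PP) / \<epsilon>\<^sup>2"
      using integral_Markov_inequality_measure[OF int sets.top, of "\<epsilon>\<^sup>2"] \<epsilon> by simp
    also have "\<dots> \<le> ?R / \<epsilon>\<^sup>2"
      using P2 by (rule divide_right_mono) simp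
    also have "\<dots> \<le> 4 * (?R / \<epsilon>\<^sup>2)"
      using mult_right_mono[OF _ R0, of 1 4]
      by (simp only: mult_1 one_le_numeral True_implies_equals)
    finally show ?thesis by (simp add: mult.assoc)
  qed
  show ?thesis
    using P1 P2 P3 unfolding F_def by blast
qed

end
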